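(* Let $X\subset\mathbb{P}_n$ be an arithmetically Cohen-Macaulay projective subscheme of pure dimension $m\ge1$ and degree $d$, with characteristic sequence $(m_i)_{0\le i\le d-1}$, and let $Y\subset X$ be an ACM hypersurface of $X$ with relative characteristic sequence $(n_i)_{0\le i\le d-1}$. Then $n_i\ge m_i$ for all $i$. Moreover, if $Y'\subset X$ is an ACM hypersurface of $X$, with relative characteristic sequence $(n_i')_{0\le i\le d-1}$, which contains $Y$, then $n_i'\ge n_i$ for all $i$.
   Context: $k$ is an algebraically closed field of characteristic $0$, $A_n=k[X_0,\dots,X_n]$. A projective subscheme $X\subset\mathbb{P}_n$ is given by its saturated homogeneous ideal $I_X$; $A_X=A_n/I_X$ and $\phi_X(l)=\dim_k A_X(l)$. $B[a](l)=B(a+l)$ denotes the shift of a graded module. $X$ of dimension $m$ is arithmetically Cohen-Macaulay (ACM) if $A_X$ admits a regular sequence of $m+1$ homogeneous polynomials. Characteristic sequence: if $X$ is ACM of pure dimension $m$ and degree $d$, and $Y_0,\dots,Y_m$ are linear forms whose common zero locus does not meet $X$, put $R_m=k[Y_0,\dots,Y_m]$. Then $A_X\simeq\bigoplus_{i=0}^{d-1}R_m[-m_i]$ as graded $R_m$-modules with $0=m_0\le\dots\le m_{d-1}$; the sequence $(m_i)$ depends only on $\phi_X$ and is the (absolute) characteristic sequence of $X$. Relative characteristic sequence: an ACM hypersurface of $X$ is an ACM closed subscheme $Y\subset X$ of pure dimension $m-1$. The kernel $I_{Y/X}=I_Y/I_X$ of $A_X\to A_Y$ is a graded free $R_m$-module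 of rank $d$, $I_{Y/X}\simeq\bigoplus_{i=0}^{d-1}R_m[-n_i]$ with $n_0\le\dots\le n_{d-1}$; $(n_i)$ is the relative characteristic sequence of $Y$ (relative to $X$). *)

theory Defs
  imports
    "HOL-Algebra.Algebra"
    "HOL-Library.Poly_Mapping"
    "HOL-Computational_Algebra.Polynomial"
begin

section \<open>The graded ring \<open>A_n = k[X_0, \<dots>, X_n]\<close>\<close>

text \<open>
  Polynomials in the countably many variables \<open>X_0, X_1, \<dots>\<close> are finitely supported functions
  from monomials to \<open>k\<close>; \<open>A_n\<close> is the subring of those that involve only \<open>X_0, \<dots>, X_n\<close>.
\<close>

type_synonym 'k mpoly = "(nat \<Rightarrow>\<^sub>0 nat) \<Rightarrow>\<^sub>0 'k"

definition mon_degree :: "(nat \<Rightarrow>\<^sub>0 nat) \<Rightarrow> nat" where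
  "mon_degree t = (\<Sum>i\<in>Poly_Mapping.keys t. Poly_Mapping.lookup t i)"

definition mpoly_ring :: "nat \<Rightarrow> 'k::field mpoly ring" where
  "mpoly_ring n =
    \<lparr>carrier = {p. \<forall>t\<in>Poly_Mapping.keys p. Poly_Mapping.keys t \<subseteq> {..n}},
     monoid.mult = (*), one = 1, ring.zero = 0, ring.add = (+)\<rparr>"

definition homog :: "nat \<Rightarrow> int \<Rightarrow> 'k::field mpoly set" where
  "homog n l = {p \<in> carrier (mpoly_ring n). \<forall>t\<in>Poly_Mapping.keys p. int (mon_degree t) = l}"

definition homogs :: "nat \<Rightarrow> 'k::field mpoly set" where
  "homogs n = (\<Union>l. homog n l)"

definition scalars :: "'k::field mpoly set" where
  "scalars = range (\<lambda>c. Poly_Mapping.single 0 c)"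


section \<open>Projective subschemes\<close>

definition homogeneous_ideal :: "nat \<Rightarrow> 'k::field mpoly set \<Rightarrow> bool" where
  "homogeneous_ideal n I \<longleftrightarrow>
     ideal I (mpoly_ring n) \<and> I = genideal (mpoly_ring n) (I \<inter> homogs n)"

definition saturated :: "nat \<Rightarrow> 'k::field mpoly set \<Rightarrow> bool" where
  "saturated n I \<longleftrightarrow>
     (\<forall>f\<in>carrier (mpoly_ring n). (\<exists>N::nat. \<forall>g\<in>homog n (int N). g * f \<in> I) \<longrightarrow> f \<in> I)"

definition proj_subscheme :: "nat \<Rightarrow> 'k::field mpoly set \<Rightarrow> bool" where
  "proj_subscheme n I \<longleftrightarrow> homogeneous_ideal n I \<and> saturated n I"

text \<open>
  The points of the scheme \<open>Proj (A_n / I)\<close>: homogeneous primes containing \<open>I\<close> but not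
  the irrelevant ideal, i.e. not all linear forms.
\<close>

definition proj_points :: "nat \<Rightarrow> 'k::field mpoly set \<Rightarrow> 'k mpoly set set" where
  "proj_points n I =
     {P. primeideal P (mpoly_ring n) \<and> homogeneous_ideal n P \<and> I \<subseteq> P \<and> \<not> homog n 1 \<subseteq> P}"

text \<open>
  A chain with \<open>r + 1\<close> members is a strict chain \<open>P_0 \<subset> \<dots> \<subset> P_r\<close>, of length \<open>r\<close>.
\<close>

definition has_krull_dim :: "'a set set \<Rightarrow> nat \<Rightarrow> bool" where
  "has_krull_dim S m \<longleftrightarrow>
     (\<exists>C\<subseteq>S. finite C \<and> chain\<^sub>\<subseteq> C \<and> card C = m + 1) \<and>
     (\<forall>C\<subseteq>S. finite C \<longrightarrow> chain\<^sub>\<subseteq> C \<longrightarrow> card C \<le> m + 1)"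

text \<open>
  The irreducible components are the closures of the minimal points \<open>P\<close>; the points of the
  component belonging to \<open>P\<close> are \<open>proj_points n P\<close>.
\<close>

definition pure_dim :: "nat \<Rightarrow> nat \<Rightarrow> 'k::field mpoly set \<Rightarrow> bool" where
  "pure_dim n m I \<longleftrightarrow>
     proj_points n I \<noteq> {} \<and>
     (\<forall>P\<in>proj_points n I. (\<forall>Q\<in>proj_points n I. Q \<subseteq> P \<longrightarrow> Q = P) \<longrightarrow>
        has_krull_dim (proj_points n P) m)"

definition coord_ring :: "nat \<Rightarrow> 'k::field mpoly set \<Rightarrow> 'k mpoly set ring" where
  "coord_ring n I = mpoly_ring n Quot I"

definition hilbert_function :: "nat \<Rightarrow> 'k::field mpoly set \<Rightarrow> nat \<Rightarrow> nat" where
  "hilbert_function n I l =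
     (THE r. ring.dimension (coord_ring n I) r
        ((\<lambda>c. I +>\<^bsub>mpoly_ring n\<^esub> c) ` scalars)
        ((\<lambda>f. I +>\<^bsub>mpoly_ring n\<^esub> f) ` homog n (int l)))"

text \<open>The degree, for a scheme of dimension \<open>m\<close>: \<open>m!\<close> times the leading coefficient of the
  Hilbert polynomial.\<close>

definition has_degree :: "nat \<Rightarrow> nat \<Rightarrow> 'k::field mpoly set \<Rightarrow> nat \<Rightarrow> bool" where
  "has_degree n m I d \<longleftrightarrow>
     (\<exists>p :: rat poly. degree p = m \<and> fact m * lead_coeff p = of_nat d \<and>
        (\<forall>\<^sub>F l in sequentially. of_nat (hilbert_function n I l) = poly p (of_nat l)))"


section \<open>Arithmetically Cohen-Macaulay subschemes\<close>

text \<open>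
  \<open>fs\<close> is regular on \<open>A_n / I\<close>: each \<open>f_i\<close> is a nonzerodivisor on
  \<open>A_n / (I + (f_0, \<dots>, f_{i-1}))\<close>, and \<open>A_n / (I + (fs))\<close> is nonzero.
\<close>

definition regular_sequence :: "nat \<Rightarrow> 'k::field mpoly set \<Rightarrow> 'k mpoly list \<Rightarrow> bool" where
  "regular_sequence n I fs \<longleftrightarrow>
     set fs \<subseteq> carrier (mpoly_ring n) \<and>
     (\<forall>i<length fs. \<forall>g\<in>carrier (mpoly_ring n).
        fs ! i * g \<in> genideal (mpoly_ring n) (I \<union> set (take i fs)) \<longrightarrow>
        g \<in> genideal (mpoly_ring n) (I \<union> set (take i fs))) \<and>
     genideal (mpoly_ring n) (I \<union> set fs) \<noteq> carrier (mpoly_ring n)"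

definition acm_pure :: "nat \<Rightarrow> nat \<Rightarrow> 'k::field mpoly set \<Rightarrow> bool" where
  "acm_pure n m I \<longleftrightarrow>
     proj_subscheme n I \<and> pure_dim n m I \<and>
     (\<exists>fs. length fs = m + 1 \<and> set fs \<subseteq> homogs n \<and> regular_sequence n I fs)"

definition acm_hypersurface ::
    "nat \<Rightarrow> nat \<Rightarrow> 'k::field mpoly set \<Rightarrow> 'k mpoly set \<Rightarrow> bool" where
  "acm_hypersurface n m I J \<longleftrightarrow> acm_pure n (m - 1) J \<and> I \<subseteq> J"


section \<open>Graded modules\<close>

text \<open>
  As for \<^locale>\<open>module\<close>, the fields \<open>mult\<close> and \<open>one\<close> inherited from the ring record are
  irrelevant for the module structure.
\<close>

record ('a, 'b) graded_module = "('a, 'b) module" +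
  component :: "int \<Rightarrow> 'b set"

definition shift ::
    "('a, 'b) graded_module \<Rightarrow> int \<Rightarrow> ('a, 'b) graded_module" where
  "shift M a = M\<lparr>component := (\<lambda>l. component M (a + l))\<rparr>"

definition direct_sum ::
    "nat \<Rightarrow> (nat \<Rightarrow> ('a, 'b) graded_module) \<Rightarrow> ('a, nat \<Rightarrow> 'b) graded_module" where
  "direct_sum d M =
    \<lparr>carrier = (\<Pi>\<^sub>E i\<in>{..<d}. carrier (M i)),
     monoid.mult = (\<lambda>x y. \<lambda>i\<in>{..<d}. x i \<otimes>\<^bsub>M i\<^esub> y i),
     one = (\<lambda>i\<in>{..<d}. \<one>\<^bsub>M i\<^esub>),
     ring.zero = (\<lambda>i\<in>{..<d}. \<zero>\<^bsub>M i\<^esub>),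
     ring.add = (\<lambda>x y. \<lambda>i\<in>{..<d}. x i \<oplus>\<^bsub>M i\<^esub> y i),
     module.smult = (\<lambda>r x. \<lambda>i\<in>{..<d}. r \<odot>\<^bsub>M i\<^esub> x i),
     component = (\<lambda>l. \<Pi>\<^sub>E i\<in>{..<d}. component (M i) l)\<rparr>"

definition graded_iso ::
    "('a, 'r) ring_scheme \<Rightarrow> ('a, 'b) graded_module \<Rightarrow> ('a, 'c) graded_module \<Rightarrow> bool" where
  "graded_iso R M N \<longleftrightarrow>
     (\<exists>h. bij_betw h (carrier M) (carrier N) \<and>
        (\<forall>x\<in>carrier M. \<forall>y\<in>carrier M. h (x \<oplus>\<^bsub>M\<^esub> y) = h x \<oplus>\<^bsub>N\<^esub> h y) \<and>
        (\<forall>r\<in>carrier R. \<forall>x\<in>carrier M. h (r \<odot>\<^bsub>M\<^esub> x) = r \<odot>\<^bsub>N\<^esub> h x) \<and>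
        (\<forall>l. h ` component M l = component N l))"


section \<open>Characteristic sequences\<close>

definition linear_forms_avoiding ::
    "nat \<Rightarrow> nat \<Rightarrow> 'k::field mpoly set \<Rightarrow> 'k mpoly list \<Rightarrow> bool" where
  "linear_forms_avoiding n m I Ys \<longleftrightarrow>
     length Ys = m + 1 \<and> set Ys \<subseteq> homog n 1 \<and> \<not> (\<exists>P\<in>proj_points n I. set Ys \<subseteq> P)"

text \<open>
  \<open>R_m = k[Y_0, \<dots>, Y_m]\<close> as a subring of \<open>A_n\<close>. Linear forms without common zero on a
  scheme of dimension \<open>m\<close> are algebraically independent, so this is a polynomial ring.
\<close>

definition lin_ring :: "nat \<Rightarrow> 'k::field mpoly list \<Rightarrow> 'k mpoly ring" where
  "lin_ring n Ys =
     (mpoly_ring n)\<lparr>carrier := generate_ring (mpoly_ring n) (scalars \<union> set Ys)\<rparr>"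

definition lin_module ::
    "nat \<Rightarrow> 'k::field mpoly list \<Rightarrow> ('k mpoly, 'k mpoly) graded_module" where
  "lin_module n Ys =
    \<lparr>carrier = carrier (lin_ring n Ys),
     monoid.mult = (*), one = 1, ring.zero = 0, ring.add = (+), module.smult = (*),
     component = (\<lambda>l. carrier (lin_ring n Ys) \<inter> homog n l)\<rparr>"

text \<open>
  For ideals \<open>I \<subseteq> J\<close> of \<open>A_n\<close>, the graded submodule \<open>J / I\<close> of \<open>A_n / I\<close>; a polynomial
  acts through its class. With \<open>I = I_X\<close>, the ideal \<open>J = A_n\<close> gives \<open>A_X\<close>, and \<open>J = I_Y\<close>
  gives \<open>I_{Y/X}\<close>.
\<close>

definition quot_module ::
    "nat \<Rightarrow> 'k::field mpoly set \<Rightarrow> 'k mpoly set \<Rightarrow> ('k mpoly, 'k mpoly set) graded_module" where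
  "quot_module n J I =
    \<lparr>carrier = (\<lambda>f. I +>\<^bsub>mpoly_ring n\<^esub> f) ` J,
     monoid.mult = (\<otimes>\<^bsub>coord_ring n I\<^esub>),
     one = \<one>\<^bsub>coord_ring n I\<^esub>,
     ring.zero = \<zero>\<^bsub>coord_ring n I\<^esub>,
     ring.add = (\<oplus>\<^bsub>coord_ring n I\<^esub>),
     module.smult = (\<lambda>r x. (I +>\<^bsub>mpoly_ring n\<^esub> r) \<otimes>\<^bsub>coord_ring n I\<^esub> x),
     component = (\<lambda>l. (\<lambda>f. I +>\<^bsub>mpoly_ring n\<^esub> f) ` (J \<inter> homog n l))\<rparr>"

text \<open>
  \<open>M \<simeq> R_m[-s_0] \<oplus> \<dots> \<oplus> R_m[-s_{d-1}]\<close> with \<open>s\<close> nondecreasing of length \<open>d\<close>.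
\<close>

definition free_with_shifts ::
    "nat \<Rightarrow> 'k::field mpoly list \<Rightarrow> ('k mpoly, 'b) graded_module \<Rightarrow> nat \<Rightarrow> nat list \<Rightarrow> bool" where
  "free_with_shifts n Ys M d s \<longleftrightarrow>
     length s = d \<and> sorted s \<and>
     graded_iso (lin_ring n Ys) (direct_sum d (\<lambda>i. shift (lin_module n Ys) (- int (s ! i)))) M"

text \<open>
  The sequences do not depend on the choice of \<open>Y_0, \<dots>, Y_m\<close>; in particular the absolute and
  the relative one may be computed with different linear forms.
\<close>

definition characteristic_sequence ::
    "nat \<Rightarrow> nat \<Rightarrow> 'k::field mpoly set \<Rightarrow> nat \<Rightarrow> nat list \<Rightarrow> bool" where
  "characteristic_sequence n m I d ms \<longleftrightarrow>
     (\<exists>Ys. linear_forms_avoiding n m I Ys \<and>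
        free_with_shifts n Ys (quot_module n (carrier (mpoly_ring n)) I) d ms) \<and>
     (d > 0 \<longrightarrow> ms ! 0 = 0)"

definition relative_characteristic_sequence ::
    "nat \<Rightarrow> nat \<Rightarrow> 'k::field mpoly set \<Rightarrow> 'k mpoly set \<Rightarrow> nat \<Rightarrow> nat list \<Rightarrow> bool" where
  "relative_characteristic_sequence n m I J d ns \<longleftrightarrow>
     (\<exists>Ys. linear_forms_avoiding n m I Ys \<and>
        free_with_shifts n Ys (quot_module n J I) d ns)"

end

theory Submission
  imports Defs "Jordan_Normal_Form.Determinant"
begin

text \<open>
  Let \<open>I \<subseteq> J\<^sub>1 \<subseteq> J\<^sub>2\<close> be ideals such that \<open>J\<^sub>1 / I\<close> is graded free over \<open>k[Z]\<close> and \<open>J\<^sub>2 / I\<close>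
  over \<open>k[Z']\<close>, where \<open>Z\<close>, \<open>Z'\<close> are linearly independent linear forms. Comparing the growth of
  Hilbert functions, \<open>Z\<close> and \<open>Z'\<close> have the same length. Freeness is an open condition on the
  line \<open>Z + t (Z' - Z)\<close>: in each degree it is the nonvanishing of a determinant, polynomial in
  \<open>t\<close>, and finitely many degrees suffice because \<open>J / I\<close> is a module over a ring generated in
  degree one. So for almost all \<open>t\<close> both modules are free, with unchanged shifts, over the same
  polynomial ring. If the \<open>i\<close>-th shift of \<open>J\<^sub>1 / I\<close> were smaller than that of \<open>J\<^sub>2 / I\<close>, a free
  module of rank \<open>i + 1\<close> would embed into one of rank \<open>i\<close>.\<close>

subsection \<open>Linear algebra\<close>

text \<open>The rank argument needs one polynomial ring acting freely on both modules, whereas each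
  characteristic sequence comes with its own linear forms. The deformation supplies that common
  ring; it needs infinitely many scalars, provided here by characteristic \<open>0\<close>. Only
  spanning is carried along the line of forms. Independence follows by counting, since the original
  basis fixes the dimension of each piece and the deformed family has exactly that many members.

  Dimensions are counted in degrees at most \<open>L\<close>, and both the comparison of the numbers
  of forms and that of the shifts end in the same contradiction:
  \<open>(k + 1) * G L \<le> k * G (L + c)\<close> for a positive, polynomially bounded
  \<open>G\<close>. This takes the place of Hilbert polynomials and fraction fields. Both claims of
  the theorem are one statement about \<open>J\<^sub>1 \<subseteq> J\<^sub>2\<close>; in the first,
  \<open>J\<^sub>2\<close> is the whole ring.\<close>

context vector_space
begin

lemma span_family:
  assumes "x \<in> span (f ` S)" "finite S"
  shows "\<exists>c. x = (\<Sum>a\<in>S. scale (c a) (f a))"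
  using assms(1)
proof (induction rule: span_induct_alt)
  case base
  show ?case by (rule exI[of _ "\<lambda>_. 0"]) simp
next
  case (step c x y)
  then obtain d a where d: "y = (\<Sum>a\<in>S. scale (d a) (f a))" and a: "a \<in> S" "x = f a" by auto
  have "(\<Sum>i\<in>S. scale (d i + (if i = a then c else 0)) (f i))
      = (\<Sum>i\<in>S. scale (d i) (f i)) + (\<Sum>i\<in>S. if i = a then scale c (f i) else 0)"
    unfolding sum.distrib[symmetric] by (rule sum.cong) (auto simp: scale_left_distrib)
  also have "\<dots> = scale c x + y" using a d assms(2) by (simp add: add.commute)
  finally show ?case by (intro exI) (rule sym)
qed

text \<open>A basis inside the image already has \<open>card S\<close> elements, as many as the
  image can have, so it is the whole image and nothing was identified. The equation of numbers thus
  encodes independence of a family, repetitions excluded.\<close>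

lemma dim_image_eq_card_imp:
  assumes "finite S" "dim (f ` S) = card S"
  shows "inj_on f S" "independent (f ` S)"
proof -
  obtain B where B: "B \<subseteq> f ` S" "independent B" "f ` S \<subseteq> span B" "card B = dim (f ` S)"
    by (rule basis_exists)
  have "card (f ` S) \<le> card S" by (rule card_image_le) fact
  then have "B = f ` S" using B assms by (intro card_seteq) auto
  then show "independent (f ` S)" "inj_on f S" using B assms by (auto intro: eq_card_imp_inj_on)
qed

lemma dim_image_eq_card_iff:
  assumes "finite S"
  shows "dim (f ` S) = card S \<longleftrightarrow>
    (\<forall>c. (\<Sum>a\<in>S. scale (c a) (f a)) = 0 \<longrightarrow> (\<forall>a\<in>S. c a = 0))" (is "_ \<longleftrightarrow> ?R")
proof
  assume "dim (f ` S) = card S"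
  from dim_image_eq_card_imp[OF assms this] have i: "inj_on f S" and d: "independent (f ` S)" .
  show ?R
  proof (intro allI impI ballI)
    fix c a assume s: "(\<Sum>a\<in>S. scale (c a) (f a)) = 0" and a: "a \<in> S"
    have "(\<Sum>x\<in>f ` S. scale (c (the_inv_into S f x)) x) = 0"
      using s by (simp add: sum.reindex[OF i] the_inv_into_f_f[OF i])
    then have "c (the_inv_into S f (f a)) = 0"
      using d a assms by (intro independentD[of "f ` S" "f ` S" "\<lambda>x. c (the_inv_into S f x)"]) auto
    then show "c a = 0" using a i by (simp add: the_inv_into_f_f)
  qed
next
  assume R: ?R
  have i: "inj_on f S"
  proof (rule inj_onI, rule ccontr)
    fix a b assume ab: "a \<in> S" "b \<in> S" "f a = f b" "a \<noteq> b"
    let ?c = "\<lambda>x. if x = a then 1 else if x = b then -1 else (0 :: 'a)"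
    have "(\<Sum>x\<in>S. scale (?c x) (f x)) = (\<Sum>x\<in>{a,b}. scale (?c x) (f x))"
      by (rule sum.mono_neutral_right) (use ab assms in auto)
    also have "\<dots> = 0" using ab by simp
    finally have "?c a = 0" using R[rule_format, of ?c a] ab by blast
    then show False by simp
  qed
  have "independent (f ` S)"
  proof (rule independent_if_scalars_zero)
    show "finite (f ` S)" using assms by simp
    fix g x assume s: "(\<Sum>x\<in>f ` S. scale (g x) x) = 0" and x: "x \<in> f ` S"
    have "(\<Sum>a\<in>S. scale (g (f a)) (f a)) = 0" using s by (simp add: sum.reindex[OF i])
    then show "g x = 0" using R x by fastforce
  qed
  then show "dim (f ` S) = card S" using i by (simp add: dim_eq_card_independent card_image)
qed

lemma dim_image_le_card: "finite S \<Longrightarrow> dim (f ` S) \<le> card S"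
  using dim_le_card[OF span_superset finite_imageI] card_image_le by (rule order_trans)

lemma dim_mono_finite:
  assumes "A \<subseteq> span B" "finite B"
  shows "dim A \<le> dim B"
proof -
  obtain C where C: "C \<subseteq> B" "independent C" "B \<subseteq> span C" "card C = dim B"
    by (rule basis_exists)
  have "A \<subseteq> span C" using assms(1) C(3) using span_minimal[OF C(3) subspace_span] by blast
  moreover have "finite C" using C(1) assms(2) finite_subset by blast
  ultimately show ?thesis using dim_le_card[of A C] C(4) by simp
qed

lemma dim_image_eq_card_subset:
  assumes "finite S" "dim (f ` S) = card S" "T \<subseteq> S"
  shows "dim (f ` T) = card T"
proof -
  note i = dim_image_eq_card_imp[OF assms(1,2)]
  have "independent (f ` T)" using independent_mono[OF i(2)] assms(3) by blast
  moreover have "inj_on f T" using i(1) assms(3) by (rule inj_on_subset)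
  ultimately show ?thesis by (simp add: dim_eq_card_independent card_image)
qed

text \<open>The determinant of the coordinates of the perturbed vectors is a polynomial in \<open>t\<close> with
  value \<open>1\<close> at \<open>0\<close>.\<close>

lemma finite_degenerate_parameters:
  fixes u :: "'i \<Rightarrow> nat \<Rightarrow> 'b" and N :: nat
  defines "B S \<equiv> (\<lambda>a. u a 0) ` S"
    and "v t a \<equiv> (\<Sum>k\<le>N. scale (t ^ k) (u a k))"
  assumes fin: "finite S" and dim: "dim (B S) = card S"
    and u: "\<And>a k. a \<in> S \<Longrightarrow> u a k \<in> span (B S)"
  shows "finite {t. \<not> B S \<subseteq> span (v t ` S)}"
proof -
  note ind = dim_image_eq_card_imp[OF fin dim[unfolded B_def]]
  define m where "m = card S"
  obtain e where e: "bij_betw e {..<m} S"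
    using fin unfolding m_def by (metis atLeast0LessThan ex_bij_betw_nat_finite)
  define \<phi> where "\<phi> x j = representation (B S) x (u (e j) 0)" for x j
  define p where "p i j = (\<Sum>k\<le>N. monom (\<phi> (u (e i) k) j) k)" for i j
  \<comment> \<open>Row \<open>i\<close> holds the coordinates of the perturbed vector
    \<open>v t (e i)\<close>, as polynomials in \<open>t\<close>.\<close>
  define M where "M = mat m m (\<lambda>(i,j). p i j)"
  have indB: "independent (B S)" using ind(2) by (simp add: B_def)
  have eS: "e i \<in> S" if "i < m" for i using e that by (auto simp: bij_betw_def)
  have repr: "x = (\<Sum>j<m. scale (\<phi> x j) (u (e j) 0))" if "x \<in> span (B S)" for x
  proof -
    have "x = (\<Sum>b\<in>B S. scale (representation (B S) x b) b)"
      using sum_representation_eq[OF indB that, of "B S"] fin by (simp add: B_def)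
    also have "\<dots> = (\<Sum>a\<in>S. scale (representation (B S) x (u a 0)) (u a 0))"
      unfolding B_def by (rule sum.reindex[OF ind(1), unfolded o_def])
    also have "\<dots> = (\<Sum>j<m. scale (\<phi> x j) (u (e j) 0))"
      unfolding \<phi>_def by (rule sum.reindex_bij_betw[OF e, symmetric])
    finally show ?thesis .
  qed
  have pol: "poly (p i j) t = \<phi> (v t (e i)) j" if "i < m" for i j t
  proof -
    have "\<phi> (v t (e i)) j = (\<Sum>k\<le>N. t ^ k * \<phi> (u (e i) k) j)"
      unfolding \<phi>_def v_def using u[OF eS[OF that]] indB
      by (subst representation_sum) (auto simp: span_scale representation_scale)
    then show ?thesis by (simp add: p_def poly_sum poly_monom mult.commute)
  qed
  have vspan: "v t a \<in> span (B S)" if "a \<in> S" for a t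
    unfolding v_def using u[OF that] by (intro span_sum span_scale) auto
  have "poly (p i j) 0 = (if i = j then 1 else 0)" if "i < m" "j < m" for i j
  proof -
    have "v 0 (e i) = (\<Sum>k\<in>{0}. scale (0 ^ k) (u (e i) k))"
      unfolding v_def by (rule sum.mono_neutral_right) auto
    then have "v 0 (e i) = u (e i) 0" by simp
    moreover have "u (e i) 0 \<in> B S" using eS[OF that(1)] by (simp add: B_def)
    moreover have "u (e i) 0 = u (e j) 0 \<longleftrightarrow> i = j"
      using inj_on_eq_iff[OF ind(1) eS[OF that(1)] eS[OF that(2)]]
        inj_on_eq_iff[OF bij_betw_imp_inj_on[OF e], of i j] that by simp
    ultimately show ?thesis unfolding pol[OF that(1)] \<phi>_def
      by (subst representation_basis[OF indB]) auto
  qed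
  then have one: "map_mat (\<lambda>p. poly p 0) M = 1\<^sub>m m"
    unfolding M_def by (intro eq_matI) auto
  interpret ev: comm_ring_hom "\<lambda>p :: 'a poly. poly p 0" by unfold_locales auto
  have "poly (det M) 0 = det (map_mat (\<lambda>p. poly p 0) M)" by (rule ev.hom_det[symmetric])
  also have "\<dots> = 1" unfolding one by simp
  finally have "det M \<noteq> 0" by auto
  then have fin_roots: "finite {t. poly (det M) t = 0}" by (rule poly_roots_finite)
  have "B S \<subseteq> span (v t ` S)" if t: "poly (det M) t \<noteq> 0" for t
  proof -
    have Mc: "M \<in> carrier_mat m m" by (simp add: M_def)
    \<comment> \<open>The adjugate inverts \<open>M\<close> up to the factor \<open>det M\<close>
      without leaving the polynomials. Its rows, evaluated at \<open>t\<close>, are the coefficients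
      expressing \<open>det M\<close> times an old basis vector by the perturbed ones.\<close>
    define A where "A = adj_mat M"
    have A: "A \<in> carrier_mat m m" "A * M = det M \<cdot>\<^sub>m 1\<^sub>m m"
      using adj_mat[OF Mc] by (auto simp: A_def)
    have AM: "(\<Sum>i<m. poly (A $$ (j,i)) t * poly (p i k) t) = (if j = k then poly (det M) t else 0)"
      if "j < m" "k < m" for j k
    proof -
      have "(A * M) $$ (j,k) = (\<Sum>i<m. A $$ (j,i) * p i k)"
        using that A(1) Mc
        by (subst index_mult_mat) (auto simp: scalar_prod_def M_def atLeast0LessThan)
      moreover have "(A * M) $$ (j,k) = (if j = k then det M else 0)"
        using that by (simp add: A(2))
      ultimately have "poly (\<Sum>i<m. A $$ (j,i) * p i k) t = poly (if j = k then det M else 0) t"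
by (simp only:)
      then show ?thesis by (simp add: poly_sum)
    qed
    have "u (e j) 0 \<in> span (v t ` S)" if j: "j < m" for j
    proof -
      have "(\<Sum>i<m. scale (poly (A $$ (j,i)) t) (v t (e i)))
        = (\<Sum>i<m. scale (poly (A $$ (j,i)) t) (\<Sum>k<m. scale (poly (p i k) t) (u (e k) 0)))"
        by (intro sum.cong refl arg_cong2[of _ _ _ _ scale]) (simp add: pol repr[OF vspan[OF eS], symmetric])
      also have "\<dots> = (\<Sum>i<m. \<Sum>k<m. scale (poly (A $$ (j,i)) t * poly (p i k) t) (u (e k) 0))"
        by (simp add: scale_sum_right)
      also have "\<dots> = (\<Sum>k<m. \<Sum>i<m. scale (poly (A $$ (j,i)) t * poly (p i k) t) (u (e k) 0))"
        by (rule sum.swap)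
      also have "\<dots> = (\<Sum>k<m. scale (if j = k then poly (det M) t else 0) (u (e k) 0))"
        using AM j by (intro sum.cong refl) (simp add: scale_sum_left[symmetric])
      also have "\<dots> = (\<Sum>k<m. if j = k then scale (poly (det M) t) (u (e k) 0) else 0)"
        by (rule sum.cong) auto
      also have "\<dots> = scale (poly (det M) t) (u (e j) 0)" using j by simp
      finally have eq: "(\<Sum>i<m. scale (poly (A $$ (j,i)) t) (v t (e i)))
        = scale (poly (det M) t) (u (e j) 0)" .
      have "scale (poly (det M) t) (u (e j) 0) \<in> span (v t ` S)"
        unfolding eq[symmetric] using eS by (intro span_sum span_scale span_base) auto
      from span_scale[OF this, of "inverse (poly (det M) t)"] show ?thesis using t by simp
    qed
    then show ?thesis using e by (auto simp: B_def bij_betw_def)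
  qed
  then have "{t. \<not> B S \<subseteq> span (v t ` S)} \<subseteq> {t. poly (det M) t = 0}" by blast
  then show ?thesis using fin_roots by (rule finite_subset)
qed

end

subsection \<open>Counting monomials\<close>

lemma mon_degree_superset:
  assumes "finite A" "Poly_Mapping.keys t \<subseteq> A"
  shows "mon_degree t = (\<Sum>i\<in>A. Poly_Mapping.lookup t i)"
  unfolding mon_degree_def using assms
  by (intro sum.mono_neutral_left) (auto simp: in_keys_iff)

lemma mon_degree_add [simp]: "mon_degree (s + t) = mon_degree s + mon_degree t"
proof -
  let ?A = "Poly_Mapping.keys s \<union> Poly_Mapping.keys t"
  have "mon_degree (s + t) = (\<Sum>i\<in>?A. Poly_Mapping.lookup (s + t) i)"
    using Poly_Mapping.keys_add[of s t] by (intro mon_degree_superset) auto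
  also have "\<dots> = mon_degree s + mon_degree t"
    by (simp add: lookup_add sum.distrib mon_degree_superset[of ?A s] mon_degree_superset[of ?A t])
  finally show ?thesis .
qed

lemma mon_degree_0 [simp]: "mon_degree 0 = 0"
  by (simp add: mon_degree_def)

lemma mon_degree_single [simp]: "mon_degree (Poly_Mapping.single i k) = k"
  by (simp add: mon_degree_def)

lemma lookup_le_mon_degree: "Poly_Mapping.lookup t i \<le> mon_degree t"
proof (cases "i \<in> Poly_Mapping.keys t")
  case True
  then show ?thesis unfolding mon_degree_def by (intro member_le_sum) auto
qed (simp add: in_keys_iff)

text \<open>Degrees up to \<open>L\<close> rather than exactly \<open>L\<close> keep the count
  positive and monotone, even for \<open>r = 0\<close>.\<close>

definition mons :: "nat \<Rightarrow> nat \<Rightarrow> (nat \<Rightarrow>\<^sub>0 nat) set" where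
  "mons r L = {t. Poly_Mapping.keys t \<subseteq> {..<r} \<and> mon_degree t \<le> L}"

lemma mons_inj: "inj_on (\<lambda>t. restrict (Poly_Mapping.lookup t) {..<r}) (mons r L)"
proof (rule inj_onI)
  fix s t assume st: "s \<in> mons r L" "t \<in> mons r L"
    and eq: "restrict (Poly_Mapping.lookup s) {..<r} = restrict (Poly_Mapping.lookup t) {..<r}"
  show "s = t"
  proof (rule poly_mapping_eqI)
    fix i
    show "Poly_Mapping.lookup s i = Poly_Mapping.lookup t i"
    proof (cases "i < r")
      case True
      then show ?thesis using fun_cong[OF eq, of i] by simp
    next
      case False
      then have "i \<notin> Poly_Mapping.keys s" "i \<notin> Poly_Mapping.keys t"
        using st by (auto simp: mons_def)
      then show ?thesis by (simp add: in_keys_iff)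
    qed
  qed
qed

lemma mons_image:
  "(\<lambda>t. restrict (Poly_Mapping.lookup t) {..<r}) ` mons r L \<subseteq> (\<Pi>\<^sub>E i\<in>{..<r}. {..L})"
  using order_trans[OF lookup_le_mon_degree] by (auto simp: mons_def split: if_splits)

lemma finite_mons [simp]: "finite (mons r L)"
  by (rule inj_on_finite[OF mons_inj mons_image]) (simp add: finite_PiE)

lemma card_mons_le: "card (mons r L) \<le> (L + 1) ^ r"
  using card_inj_on_le[OF mons_inj[of r L] mons_image]
  by (simp add: finite_PiE card_PiE)

lemma card_mons_pos: "1 \<le> card (mons r L)"
proof -
  have "0 \<in> mons r L" by (simp add: mons_def)
  then show ?thesis using card_mono[OF finite_mons, of "{0}" r L] by simp
qed

lemma mons_mono: "r \<le> r' \<Longrightarrow> L \<le> L' \<Longrightarrow> mons r L \<subseteq> mons r' L'"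
  unfolding mons_def by (auto intro: order_trans less_le_trans)

lemma card_mons_mono: "r \<le> r' \<Longrightarrow> L \<le> L' \<Longrightarrow> card (mons r L) \<le> card (mons r' L')"
  by (intro card_mono mons_mono) simp_all

text \<open>The exponent \<open>L - k\<close> given to the new variable records \<open>k\<close>, so
  disjoint copies of the smaller sets fit into the larger one. One more variable amounts to a
  summation over degrees.\<close>

lemma sum_card_mons_le: "(\<Sum>k\<le>L. card (mons r k)) \<le> card (mons (Suc r) L)"
proof -
  let ?f = "\<lambda>(k, t). t + Poly_Mapping.single r (L - k)"
  have r0: "Poly_Mapping.lookup t r = 0" if "t \<in> mons r k" for t k
    using that by (auto simp: mons_def in_keys_iff)
  have "inj_on ?f (SIGMA k:{..L}. mons r k)"
  proof (rule inj_onI, clarsimp)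
    fix k s k' t
    assume *: "k \<le> L" "k' \<le> L" "s \<in> mons r k" "t \<in> mons r k'"
      and eq: "s + Poly_Mapping.single r (L - k) = t + Poly_Mapping.single r (L - k')"
    from arg_cong[OF eq, of "\<lambda>x. Poly_Mapping.lookup x r"] have "k = k'"
      using * r0 by (auto simp: lookup_add)
    then show "k = k' \<and> s = t" using eq by simp
  qed
  moreover have "?f ` (SIGMA k:{..L}. mons r k) \<subseteq> mons (Suc r) L"
  proof (rule image_subsetI)
    fix x
    assume "x \<in> (SIGMA k:{..L}. mons r k)"
    then obtain k t where x: "x = (k, t)" and "k \<le> L" "t \<in> mons r k" by blast
    moreover have "Poly_Mapping.keys (t + Poly_Mapping.single r (L - k))
        \<subseteq> Poly_Mapping.keys t \<union> {r}"
      using Poly_Mapping.keys_add[of t "Poly_Mapping.single r (L - k)"] by (auto split: if_splits)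
    ultimately show "?f x \<in> mons (Suc r) L"
      unfolding mons_def by (auto simp: less_Suc_eq)
  qed
  ultimately have "card (SIGMA k:{..L}. mons r k) \<le> card (mons (Suc r) L)"
    by (rule card_inj_on_le) simp
  then show ?thesis by simp
qed

text \<open>Iterating \<open>step\<close> gives \<open>G (j * c) \<ge> (1 + 1/k) ^ j\<close>, which
  outgrows any power of \<open>j\<close>. Bernoulli's inequality, applied to an exponent split into
  \<open>r + 1\<close> equal parts, gives a polynomial of degree \<open>r + 1\<close> below one of
  degree \<open>r\<close>.\<close>

lemma no_exponential_growth:
  fixes G :: "nat \<Rightarrow> nat"
  assumes pos: "\<And>L. 1 \<le> G L" and le: "\<And>L. G L \<le> (L + 1) ^ r"
    and step: "\<And>L. (k + 1) * G L \<le> k * G (L + c)"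
  shows False
proof (cases "k = 0")
  case True
  then show False using step[of 0] pos[of 0] by simp
next
  case False
  define x where "x = 1 / real k"
  have x: "x > 0" "x * k = 1" using False by (auto simp: x_def)
  have st: "(1 + x) * G L \<le> G (L + c)" for L
  proof -
    have "real ((k + 1) * G L) \<le> real (k * G (L + c))" using step of_nat_le_iff by blast
    moreover have "(1 + x) * G L * k = k * G L + (x * k) * G L" by (simp add: algebra_simps)
    then have "(1 + x) * G L * k = real ((k + 1) * G L)"
      unfolding x(2) by (simp add: algebra_simps)
    ultimately have "(1 + x) * G L * k \<le> G (L + c) * k"
      by (simp add: mult.commute)
    then show ?thesis using False by simp
  qed
  have exp: "(1 + x) ^ j \<le> G (j * c)" for j
  proof (induction j)
    case 0
    show ?case using pos[of 0] by simp
  next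
    case (Suc j)
    have "(1 + x) ^ Suc j \<le> (1 + x) * G (j * c)" using Suc x by simp
    also have "\<dots> \<le> G (j * c + c)" by (rule st)
    finally show ?case by (simp add: add.commute)
  qed
  \<comment> \<open>Chosen so that \<open>1 + i * (r + 1) * c \<le> C * (1 + i * x)\<close>, using
    \<open>x * k = 1\<close>. Cancelling \<open>r\<close> factors \<open>1 + i * x\<close> then
    leaves a bound on \<open>1 + i * x\<close> that is independent of \<open>i\<close>.\<close>
  define C where "C = 1 + real ((r + 1) * c * k)"
  have bound: "1 + i * x \<le> C ^ r" for i :: nat
  proof -
    have "(1 + i * x) ^ (r + 1) \<le> ((1 + x) ^ i) ^ (r + 1)"
      using Bernoulli_inequality[of x i] x by (intro power_mono) (auto simp: mult.commute)
    also have "\<dots> = (1 + x) ^ (i * (r + 1))" by (simp only: power_mult)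
    also have "\<dots> \<le> real ((i * (r + 1) * c + 1) ^ r)"
      using exp[of "i * (r + 1)"] le[of "i * (r + 1) * c"] by (meson of_nat_le_iff order_trans)
    also have "\<dots> = (real (i * (r + 1) * c) + 1) ^ r" by (simp add: add.commute)
    also have "\<dots> \<le> (C * (1 + i * x)) ^ r"
    proof (intro power_mono)
      have "real ((r + 1) * c * k) * (i * x) = real (i * (r + 1) * c) * (x * k)"
        by (simp add: algebra_simps)
      then have "real ((r + 1) * c * k) * (i * x) = real (i * (r + 1) * c)" using x by simp
      moreover have "C * (1 + i * x) = 1 + i * x + real ((r + 1) * c * k)
          + real ((r + 1) * c * k) * (i * x)"
        unfolding C_def by (simp add: algebra_simps)
      ultimately show "real (i * (r + 1) * c) + 1 \<le> C * (1 + i * x)" using x by simp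
    qed simp
    also have "\<dots> = C ^ r * (1 + i * x) ^ r" by (rule power_mult_distrib)
    finally have "(1 + i * x) * (1 + i * x) ^ r \<le> C ^ r * (1 + i * x) ^ r" by simp
    moreover have "0 < (1 + i * x) ^ r" using x by (intro zero_less_power) (simp add: add_pos_nonneg)
    ultimately show ?thesis by simp
  qed
  obtain i :: nat where "C ^ r < i * x" using x reals_Archimedean3 by blast
  then show False using bound[of i] by simp
qed

text \<open>With more than \<open>r'\<close> variables, the left side dominates the partial sums of
  the counts for \<open>r'\<close> variables. Each partial sum would then be at most
  \<open>d\<close> times a later summand, so the sums would grow by the factor
  \<open>1 + 1/d\<close> over steps of fixed length.\<close>

lemma card_mons_growth_le:
  assumes "\<And>L. card (mons r L) \<le> d * card (mons r' (L + c))"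
  shows "r \<le> r'"
proof (rule ccontr)
  assume "\<not> r \<le> r'"
  then have r: "Suc r' \<le> r" by simp
  define S where "S L = (\<Sum>k\<le>L. card (mons r' k))" for L
  have S1: "S L \<le> d * card (mons r' (L + (c + 1)))" for L
  proof -
    have "S L \<le> card (mons (Suc r') L)" unfolding S_def by (rule sum_card_mons_le)
    also have "\<dots> \<le> card (mons r L)" using r by (intro card_mons_mono) simp_all
    also have "\<dots> \<le> d * card (mons r' (L + c))" by fact
    also have "\<dots> \<le> d * card (mons r' (L + (c + 1)))" by (intro mult_le_mono card_mons_mono) simp_all
    finally show ?thesis .
  qed
  \<comment> \<open>The shift is \<open>c + 1\<close>, not \<open>c\<close>, so that the added
    summand is not among those of \<open>S L\<close>, even for \<open>c = 0\<close>.\<close>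
  have S2: "S L + card (mons r' (L + (c + 1))) \<le> S (L + (c + 1))" for L
  proof -
    have "S L \<le> S (L + c)" unfolding S_def by (rule sum_mono2) auto
    then show ?thesis by (simp add: S_def)
  qed
  have step: "(d + 1) * S L \<le> d * S (L + (c + 1))" for L
    using S1[of L] mult_le_mono2[OF S2[of L], of d] by (simp add: algebra_simps)
  have pos: "1 \<le> S L" for L
    unfolding S_def using card_mons_pos[of r' 0] member_le_sum[of 0 "{..L}" "\<lambda>k. card (mons r' k)"] by simp
  have "S L \<le> (L + 1) ^ Suc r'" for L
    using order_trans[OF sum_card_mons_le[of r' L] card_mons_le] unfolding S_def .
  from no_exponential_growth[of S, OF pos this step] show False .
qed

subsection \<open>Graded pieces of the polynomial ring\<close>

text \<open>Project along a complement of \<open>I\<close>. This realizes the quotient by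
  \<open>I\<close> inside the same space, so that spans and dimensions modulo \<open>I\<close> need
  no second vector space.\<close>

lemma (in vector_space) ex_linear_kernel:
  assumes "subspace I"
  shows "\<exists>\<pi>. Vector_Spaces.linear scale scale \<pi> \<and> (\<forall>x. \<pi> x = 0 \<longleftrightarrow> x \<in> I)"
proof -
  interpret vp: vector_space_pair scale scale by unfold_locales
  obtain B where B: "B \<subseteq> I" "independent B" "I \<subseteq> span B" "card B = dim I"
    by (rule basis_exists)
  define C where "C = extend_basis B"
  have C: "B \<subseteq> C" "independent C" "span C = UNIV"
    using B(2) by (simp_all add: C_def extend_basis_superset independent_extend_basis)
  define \<pi> where "\<pi> = vp.construct C (\<lambda>b. if b \<in> B then 0 else b)"
  have lin: "Vector_Spaces.linear scale scale \<pi>"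
    unfolding \<pi>_def by (rule vp.linear_construct) (rule C(2))
  have basis: "\<pi> b = (if b \<in> B then 0 else b)" if "b \<in> C" for b
    unfolding \<pi>_def using that by (rule vp.construct_basis[OF C(2)])
  interpret l: Vector_Spaces.linear scale scale \<pi> by (rule lin)
  have B0: "\<pi> x = 0" if "x \<in> span B" for x
  proof (rule l.eq_0_on_span[OF _ that])
    fix b assume "b \<in> B"
    moreover from this have "b \<in> C" using C(1) by (rule rev_subsetD)
    ultimately show "\<pi> b = 0" by (simp add: basis)
  qed
  have Cid: "\<pi> x = x" if "x \<in> span (C - B)" for x
    by (rule vp.linear_eq_on[OF lin linear_ident that]) (simp add: basis)
  have "\<pi> x = 0 \<longleftrightarrow> x \<in> I" for x
  proof
    assume "x \<in> I"
    then show "\<pi> x = 0" using B(3) by (intro B0) (rule subsetD)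
  next
    assume 0: "\<pi> x = 0"
    have "x \<in> span (B \<union> (C - B))" unfolding Un_Diff_cancel Un_absorb1[OF C(1)] C(3) by (rule UNIV_I)
    then obtain y z where yz: "x = y + z" "y \<in> span B" "z \<in> span (C - B)"
      unfolding span_Un mem_Collect_eq by (elim exE conjE) (rule that)
    have "z = 0" using 0 B0[OF yz(2)] Cid[OF yz(3)] by (simp add: yz(1) l.add)
    moreover have "span B \<subseteq> I" using B(1) assms by (rule span_minimal)
    ultimately show "x \<in> I" using yz(1,2) by (simp add: subset_eq)
  qed
  then show ?thesis using lin by (intro exI[of _ \<pi>] conjI allI)
qed

section \<open>Polynomials as a vector space over \<open>k\<close>\<close>

definition cscale :: "'k::field \<Rightarrow> 'k mpoly \<Rightarrow> 'k mpoly" where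
  "cscale c p = Poly_Mapping.single 0 c * p"

interpretation mp: vector_space "cscale :: 'k::field \<Rightarrow> _"
proof
  fix a b :: 'k and x y :: "'k mpoly"
  show "cscale a (x + y) = cscale a x + cscale a y"
    unfolding cscale_def by (rule distrib_left)
  show "cscale (a + b) x = cscale a x + cscale b x"
    unfolding cscale_def single_add by (rule distrib_right)
  show "cscale a (cscale b x) = cscale (a * b) x"
    unfolding cscale_def mult.assoc[symmetric] mult_single by simp
  show "cscale 1 x = x"
    unfolding cscale_def by simp
qed

lemma cscale_mult_left [simp]: "cscale c p * q = cscale c (p * q)"
  by (simp add: cscale_def mult.assoc)

lemma cscale_mult_right [simp]: "p * cscale c q = cscale c (p * q)"
  by (simp add: cscale_def mult.left_commute)

lemma lookup_cscale [simp]: "Poly_Mapping.lookup (cscale c p) t = c * Poly_Mapping.lookup p t"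
  unfolding cscale_def mult_map_scale_conv_mult[symmetric]
  by (simp add: Poly_Mapping.map.rep_eq when_def)

lemma keys_cscale: "Poly_Mapping.keys (cscale c p) \<subseteq> Poly_Mapping.keys p"
  by (auto simp: in_keys_iff)

lemma mem_mpoly_ring:
  "p \<in> carrier (mpoly_ring n) \<longleftrightarrow> (\<forall>t\<in>Poly_Mapping.keys p. Poly_Mapping.keys t \<subseteq> {..n})"
  by (simp add: mpoly_ring_def)

lemma mem_homog:
  "p \<in> homog n l \<longleftrightarrow> (\<forall>t\<in>Poly_Mapping.keys p.
     Poly_Mapping.keys t \<subseteq> {..n} \<and> int (mon_degree t) = l)"
  by (auto simp: homog_def mem_mpoly_ring)

lemma homog_subset_carrier: "homog n l \<subseteq> carrier (mpoly_ring n)"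
  by (auto simp: homog_def)

lemma subspace_keys: "mp.subspace {p :: 'k::field mpoly. \<forall>t\<in>Poly_Mapping.keys p. P t}"
proof (rule mp.subspaceI)
  fix x y :: "'k mpoly" and c :: 'k
  assume x: "x \<in> {p. \<forall>t\<in>Poly_Mapping.keys p. P t}"
  show "cscale c x \<in> {p. \<forall>t\<in>Poly_Mapping.keys p. P t}" using x keys_cscale[of c x] by blast
  assume "y \<in> {p. \<forall>t\<in>Poly_Mapping.keys p. P t}"
  then show "x + y \<in> {p. \<forall>t\<in>Poly_Mapping.keys p. P t}" using x Poly_Mapping.keys_add[of x y] by blast
qed simp

lemma subspace_carrier: "mp.subspace (carrier (mpoly_ring n))"
  using subspace_keys by (simp add: mpoly_ring_def)

lemma subspace_homog: "mp.subspace (homog n l :: 'k::field mpoly set)"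
proof -
  have "(homog n l :: 'k mpoly set) = {p. \<forall>t\<in>Poly_Mapping.keys p.
     Poly_Mapping.keys t \<subseteq> {..n} \<and> int (mon_degree t) = l}"
    by (simp add: set_eq_iff mem_homog)
  then show ?thesis by (simp only: subspace_keys)
qed

lemma homog_mult:
  assumes "p \<in> homog n k" "q \<in> homog n l"
  shows "p * q \<in> homog n (k + l)"
  unfolding mem_homog
proof
  fix t assume "t \<in> Poly_Mapping.keys (p * q)"
  then obtain a b where ab: "a \<in> Poly_Mapping.keys p" "b \<in> Poly_Mapping.keys q" "t = a + b"
    using Poly_Mapping.keys_mult[of p q] by blast
  then have "Poly_Mapping.keys t \<subseteq> {..n}"
    using assms Poly_Mapping.keys_add[of a b] unfolding mem_homog by blast
  then show "Poly_Mapping.keys t \<subseteq> {..n} \<and> int (mon_degree t) = k + l"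
    using ab assms unfolding mem_homog by auto
qed

lemma one_in_homog: "1 \<in> homog n 0"
  by (simp add: mem_homog)

text \<open>General in the monoid because the same monomials are later formed from polynomials and
  from pencils of linear forms, whose type is \<open>'k mpoly poly\<close>.\<close>

definition mpow :: "nat \<Rightarrow> (nat \<Rightarrow> 'a::comm_monoid_mult) \<Rightarrow> (nat \<Rightarrow>\<^sub>0 nat) \<Rightarrow> 'a" where
  "mpow r Z t = (\<Prod>p<r. Z p ^ Poly_Mapping.lookup t p)"

lemma mpow_0 [simp]: "mpow r Z 0 = 1"
  by (simp add: mpow_def)

lemma mpow_add: "mpow r Z (s + t) = mpow r Z s * mpow r Z t"
  by (simp add: mpow_def lookup_add power_add prod.distrib)

lemma mpow_single: "p < r \<Longrightarrow> mpow r Z (Poly_Mapping.single p 1) = Z p"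
proof -
  assume p: "p < r"
  have "mpow r Z (Poly_Mapping.single p 1) = (\<Prod>i<r. if i = p then Z i else 1)"
    unfolding mpow_def by (rule prod.cong) (auto simp: lookup_single)
  also have "\<dots> = Z p" using p by simp
  finally show ?thesis .
qed

text \<open>The family \<open>H\<close> is abstract since it serves three times: as the homogeneous
  pieces, as polynomials in a parameter with homogeneous coefficients, and as a constant family
  equal to a subring.\<close>

lemma mpow_graded:
  assumes one: "1 \<in> H 0" and mult: "\<And>k l x y. x \<in> H k \<Longrightarrow> y \<in> H l \<Longrightarrow> x * y \<in> H (k + l)"
    and Z: "\<And>p. p < r \<Longrightarrow> Z p \<in> H 1" and t: "Poly_Mapping.keys t \<subseteq> {..<r}"
  shows "mpow r Z t \<in> H (mon_degree t)"
proof -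
  have pow: "Z p ^ k \<in> H k" if "p < r" for p k
  proof (induction k)
    case 0
    show ?case by (simp add: one)
  next
    case (Suc k)
    show ?case using mult[OF Z[OF that] Suc] by simp
  qed
  have "(\<Prod>p<m. Z p ^ Poly_Mapping.lookup t p) \<in> H (\<Sum>p<m. Poly_Mapping.lookup t p)"
    if "m \<le> r" for m
    using that
  proof (induction m)
    case 0
    show ?case by (simp add: one)
  next
    case (Suc m)
    then show ?case using mult[OF _ pow[of m "Poly_Mapping.lookup t m"]] by simp
  qed
  from this[of r] show ?thesis
    unfolding mpow_def using mon_degree_superset[OF _ t] by simp
qed

lemma mpow_homog:
  assumes "\<And>p. p < r \<Longrightarrow> Z p \<in> homog n 1" "Poly_Mapping.keys t \<subseteq> {..<r}"
  shows "mpow r Z t \<in> homog n (int (mon_degree t))"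
  by (rule mpow_graded[where H = "\<lambda>l. homog n (int l)"])
    (use assms homog_mult in \<open>force simp: one_in_homog\<close>)+

lemma poly_mpow: "poly (mpow r Z t) x = mpow r (\<lambda>p. poly (Z p) x) t"
  by (simp add: mpow_def poly_prod poly_power)

lemma exponent_cases:
  fixes t :: "nat \<Rightarrow>\<^sub>0 nat"
  assumes "Poly_Mapping.keys t \<subseteq> {..<r}"
  obtains "t = 0" |
    p s where "p < r" "Poly_Mapping.keys s \<subseteq> {..<r}" "t = s + Poly_Mapping.single p 1"
proof (cases "t = 0")
  case False
  then obtain p where p: "p \<in> Poly_Mapping.keys t"
    using keys_eq_empty by blast
  define s where "s = t - Poly_Mapping.single p 1"
  have "t = s + Poly_Mapping.single p 1"
  proof (rule poly_mapping_eqI)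
    fix i
    show "Poly_Mapping.lookup t i = Poly_Mapping.lookup (s + Poly_Mapping.single p 1) i"
      using p by (cases "i = p") (auto simp: s_def lookup_add lookup_minus lookup_single in_keys_iff)
  qed
  moreover have "Poly_Mapping.keys s \<subseteq> Poly_Mapping.keys t"
    by (auto simp: s_def in_keys_iff lookup_minus)
  ultimately show ?thesis using that(2)[of p s] p assms by auto
qed (use that in blast)

subsection \<open>Modules \<open>J / I\<close> free over a polynomial ring in linear forms\<close>

text \<open>Homogeneous elements only, hence not a subspace. It is used through its span, which
  plays the role of the part of \<open>J\<close> of degree at most \<open>L\<close>.\<close>

definition filt :: "nat \<Rightarrow> 'k::field mpoly set \<Rightarrow> nat \<Rightarrow> 'k mpoly set" where
  "filt n J L = (\<Union>l\<le>L. J \<inter> homog n (int l))"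

lemma filt_mono: "J \<subseteq> J' \<Longrightarrow> L \<le> L' \<Longrightarrow> filt n J L \<subseteq> filt n J' L'"
  unfolding filt_def by (intro UN_mono) auto

lemma filtI: "x \<in> J \<Longrightarrow> x \<in> homog n (int l) \<Longrightarrow> l \<le> L \<Longrightarrow> x \<in> filt n J L"
  by (auto simp: filt_def)

text \<open>Labels for the expected basis, in degrees at most \<open>L\<close>, of a free module
  with shifts \<open>s\<close>: a generator together with the monomial that multiplies it. Its
  cardinality is the cumulative Hilbert function.\<close>

definition idx :: "nat \<Rightarrow> nat \<Rightarrow> (nat \<Rightarrow> nat) \<Rightarrow> nat \<Rightarrow> (nat \<times> (nat \<Rightarrow>\<^sub>0 nat)) set" where
  "idx r d s L = (SIGMA i:{..<d}. {t. Poly_Mapping.keys t \<subseteq> {..<r} \<and> mon_degree t + s i \<le> L})"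

lemma mem_idx: "(i, t) \<in> idx r d s L \<longleftrightarrow>
    i < d \<and> Poly_Mapping.keys t \<subseteq> {..<r} \<and> mon_degree t + s i \<le> L"
  by (auto simp: idx_def)

lemma idx_subset_mons: "{t. Poly_Mapping.keys t \<subseteq> {..<r} \<and> mon_degree t + s i \<le> L} \<subseteq> mons r L"
  by (auto simp: mons_def)

lemma finite_idx [simp]: "finite (idx r d s L)"
  unfolding idx_def
  by (intro finite_SigmaI finite_subset[OF idx_subset_mons]) simp_all

lemma idx_mono: "d \<le> d' \<Longrightarrow> L \<le> L' \<Longrightarrow> idx r d s L \<subseteq> idx r d' s L'"
  by (auto simp: idx_def)

lemma card_idx: "card (idx r d s L)
    = (\<Sum>i<d. card {t. Poly_Mapping.keys t \<subseteq> {..<r} \<and> mon_degree t + s i \<le> L})"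
  unfolding idx_def by (intro card_SigmaI ballI finite_subset[OF idx_subset_mons]) simp_all

lemma card_idx_le: "card (idx r d s L) \<le> d * card (mons r L)"
proof -
  have "card (idx r d s L) \<le> (\<Sum>i<d. card (mons r L))"
    unfolding card_idx by (intro sum_mono card_mono idx_subset_mons) simp
  then show ?thesis by simp
qed

lemma card_idx_ge:
  assumes "\<And>i. i < d \<Longrightarrow> s i \<le> c"
  shows "d * card (mons r L) \<le> card (idx r d s (L + c))"
proof -
  have "(\<Sum>i<d. card (mons r L)) \<le> card (idx r d s (L + c))"
    unfolding card_idx
  proof (intro sum_mono card_mono finite_subset[OF idx_subset_mons] finite_mons)
    fix i assume "i \<in> {..<d}"
    then show "mons r L \<subseteq> {t. Poly_Mapping.keys t \<subseteq> {..<r} \<and> mon_degree t + s i \<le> L + c}"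
      using assms[of i] by (auto simp: mons_def intro: add_mono)
  qed
  then show ?thesis by simp
qed

definition gen :: "nat \<Rightarrow> (nat \<Rightarrow> 'k::field mpoly) \<Rightarrow> (nat \<Rightarrow> 'k mpoly)
    \<Rightarrow> nat \<times> (nat \<Rightarrow>\<^sub>0 nat) \<Rightarrow> 'k mpoly" where
  "gen r Z b = (\<lambda>(i, t). mpow r Z t * b i)"

lemma gen_eq: "gen r Z b (i, t) = mpow r Z t * b i"
  by (simp add: gen_def)

definition absorbing :: "nat \<Rightarrow> 'k::field mpoly set \<Rightarrow> bool" where
  "absorbing n J \<longleftrightarrow> (\<forall>f\<in>carrier (mpoly_ring n). \<forall>x\<in>J. f * x \<in> J)"

lemma absorbingD: "absorbing n J \<Longrightarrow> f \<in> carrier (mpoly_ring n) \<Longrightarrow> x \<in> J \<Longrightarrow> f * x \<in> J"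
  by (simp add: absorbing_def)

lemma homog_mult_absorbing:
  assumes "absorbing n J" "f \<in> homog n (int k)" "x \<in> J" "x \<in> homog n (int l)"
  shows "f * x \<in> J" "f * x \<in> homog n (int (k + l))"
proof -
  show "f * x \<in> J"
    using assms(1) subsetD[OF homog_subset_carrier assms(2)] assms(3) by (rule absorbingD)
  show "f * x \<in> homog n (int (k + l))" using homog_mult[OF assms(2,4)] by simp
qed

lemma gen_filt:
  assumes "\<And>p. p < r \<Longrightarrow> Z p \<in> homog n 1"
    and "\<And>i. i < d \<Longrightarrow> b i \<in> J \<inter> homog n (int (s i))"
    and "absorbing n J" "(i, t) \<in> idx r d s L"
  shows "gen r Z b (i, t) \<in> filt n J L"
proof -
  have it: "i < d" "Poly_Mapping.keys t \<subseteq> {..<r}" "mon_degree t + s i \<le> L"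
    using assms(4) by (simp_all add: mem_idx)
  have "b i \<in> J" "b i \<in> homog n (int (s i))" using assms(2)[OF it(1)] by simp_all
  from homog_mult_absorbing[OF assms(3) mpow_homog[OF assms(1) it(2)] this] show ?thesis
    unfolding gen_eq by (rule filtI) (simp_all add: it(3))
qed

text \<open>\<open>\<pi>\<close> stands for the map to the quotient by \<open>I\<close>, but it is
  only linear. Products are formed before applying it, and \<open>absorb\<close> makes the result
  depend on classes only.\<close>

locale graded_quotient =
  fixes n :: nat and I :: "'k::field mpoly set" and \<pi> :: "'k mpoly \<Rightarrow> 'k mpoly"
  assumes linear: "Vector_Spaces.linear cscale cscale \<pi>"
    and kernel: "\<pi> x = 0 \<longleftrightarrow> x \<in> I"
    and absorb: "absorbing n I"
begin

sublocale l: Vector_Spaces.linear cscale cscale \<pi>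
  by (rule linear)

text \<open>Multiplication by \<open>f\<close> maps \<open>I\<close> into itself and so descends to
  the quotient: \<open>x\<close> may be replaced by a combination of elements of \<open>Y\<close>
  with the same image.\<close>

lemma mult_in_subspace:
  assumes f: "f \<in> carrier (mpoly_ring n)" and x: "\<pi> x \<in> mp.span (\<pi> ` Y)"
    and T: "mp.subspace T" and Y: "\<And>y. y \<in> Y \<Longrightarrow> \<pi> (f * y) \<in> T"
  shows "\<pi> (f * x) \<in> T"
proof -
  obtain y where y: "y \<in> mp.span Y" "\<pi> x = \<pi> y"
    using x unfolding l.span_image by (rule imageE) (rule that)
  have "\<pi> (x - y) = 0" using y(2) by (simp add: l.diff)
  then have "f * (x - y) \<in> I" using absorbingD[OF absorb f] by (simp add: kernel)
  then have "\<pi> (f * x) = \<pi> (f * y)"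
    using kernel[of "f * (x - y)"] by (simp add: right_diff_distrib l.diff)
  moreover have "\<pi> (f * y) \<in> T"
    using y(1)
  proof (induction rule: mp.span_induct_alt)
    case base
    show ?case using mp.subspace_0[OF T] by simp
  next
    case (step c y z)
    then show ?case
      using mp.subspace_add[OF T mp.subspace_scale[OF T Y[OF step(1)]] step(2)]
      by (simp add: distrib_left l.add l.scale)
  qed
  ultimately show ?thesis by simp
qed

text \<open>That is, \<open>J / I\<close> is free over the polynomial ring \<open>k[Z\<^sub>0, \<dots>, Z\<^bsub>r-1\<^esub>]\<close> on generators \<open>b i\<close> of
  degree \<open>s i\<close>; the fourth clause is the algebraic independence of the \<open>Z p\<close>.\<close>

definition free_on :: "'k mpoly set \<Rightarrow> nat \<Rightarrow> (nat \<Rightarrow> 'k mpoly) \<Rightarrow> nat \<Rightarrow> (nat \<Rightarrow> nat)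
    \<Rightarrow> (nat \<Rightarrow> 'k mpoly) \<Rightarrow> bool" where
  "free_on J r Z d s b \<longleftrightarrow>
     (\<forall>p<r. Z p \<in> homog n 1) \<and>
     (\<forall>i<d. b i \<in> J \<inter> homog n (int (s i))) \<and>
     (\<forall>L. \<pi> ` filt n J L \<subseteq> mp.span (\<pi> ` gen r Z b ` idx r d s L)) \<and>
     (\<forall>L. mp.dim (mpow r Z ` mons r L) = card (mons r L)) \<and>
     (\<forall>\<rho>. (\<forall>i<d. \<rho> i \<in> mp.span (mpow r Z ` {t. Poly_Mapping.keys t \<subseteq> {..<r}})) \<longrightarrow>
        (\<Sum>i<d. \<rho> i * b i) \<in> I \<longrightarrow> (\<forall>i<d. \<rho> i = 0))"

context
  fixes J r Z d s b
  assumes free: "free_on J r Z d s b"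
begin

lemma free_Z: "p < r \<Longrightarrow> Z p \<in> homog n 1"
  using free by (simp add: free_on_def)

lemma free_b: "i < d \<Longrightarrow> b i \<in> J \<inter> homog n (int (s i))"
  using free by (simp add: free_on_def)

lemma free_span: "\<pi> ` filt n J L \<subseteq> mp.span (\<pi> ` gen r Z b ` idx r d s L)"
  using free by (simp add: free_on_def)

lemma free_mons: "mp.dim (mpow r Z ` mons r L) = card (mons r L)"
  using free by (simp add: free_on_def)

lemma free_coeffs:
  assumes "\<And>i. i < d \<Longrightarrow> \<rho> i \<in> mp.span (mpow r Z ` {t. Poly_Mapping.keys t \<subseteq> {..<r}})"
    and "(\<Sum>i<d. \<rho> i * b i) \<in> I" "i < d"
  shows "\<rho> i = 0"
  using free assms unfolding free_on_def by meson

text \<open>Independence in two stages: collecting a relation by generators gives coefficients in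
  the polynomial ring, which vanish by freeness; then independence of the monomials in the
  \<open>Z p\<close> kills the scalars.\<close>

lemma free_dim: "mp.dim ((\<lambda>a. \<pi> (gen r Z b a)) ` idx r d s L) = card (idx r d s L)"
  unfolding mp.dim_image_eq_card_iff[OF finite_idx]
proof (intro allI impI ballI)
  fix c a
  assume sum0: "(\<Sum>a\<in>idx r d s L. cscale (c a) (\<pi> (gen r Z b a))) = 0" and a: "a \<in> idx r d s L"
  define T where "T i = {t. Poly_Mapping.keys t \<subseteq> {..<r} \<and> mon_degree t + s i \<le> L}" for i
  have T: "T i \<subseteq> mons r L" for i unfolding T_def by (rule idx_subset_mons)
  have finT: "finite (T i)" for i using T finite_mons by (rule finite_subset)
  define \<rho> where "\<rho> i = (\<Sum>t\<in>T i. cscale (c (i, t)) (mpow r Z t))" for i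
  have "(\<Sum>i<d. \<rho> i * b i) = (\<Sum>a\<in>idx r d s L. cscale (c a) (gen r Z b a))"
    unfolding idx_def \<rho>_def T_def[symmetric] sum_distrib_right
    by (subst sum.Sigma) (simp_all add: finT gen_eq split_def gen_def)
  also have "\<dots> \<in> I"
    using sum0 by (simp add: kernel[symmetric] l.sum l.scale)
  finally have I: "(\<Sum>i<d. \<rho> i * b i) \<in> I" .
  obtain i t where it: "a = (i, t)" "i < d" "t \<in> T i"
    using a unfolding idx_def T_def[symmetric] by auto
  have "\<rho> i = 0"
  proof (rule free_coeffs[OF _ I it(2)])
    fix i
    show "\<rho> i \<in> mp.span (mpow r Z ` {t. Poly_Mapping.keys t \<subseteq> {..<r}})"
      unfolding \<rho>_def by (intro mp.span_sum mp.span_scale mp.span_base) (auto simp: T_def)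
  qed
  have "mp.dim (mpow r Z ` T i) = card (T i)"
    using finite_mons free_mons T by (rule mp.dim_image_eq_card_subset)
  then have "\<forall>t\<in>T i. c (i, t) = 0"
    unfolding mp.dim_image_eq_card_iff[OF finT] using \<open>\<rho> i = 0\<close>[unfolded \<rho>_def]
    by (elim allE[of _ "\<lambda>t. c (i, t)"] mp)
  then have "c (i, t) = 0" using it(3) by (rule bspec)
  then show "c a = 0" by (simp add: it)
qed

text \<open>The dimension depends on \<open>r\<close>, \<open>d\<close> and \<open>s\<close> but not
  on the forms \<open>Z\<close>. This is what later upgrades spanning over other forms to
  independence.\<close>

lemma free_hilbert:
  assumes "absorbing n J"
  shows "mp.dim (\<pi> ` filt n J L) = card (idx r d s L)"
proof -
  have "(\<lambda>a. \<pi> (gen r Z b a)) ` idx r d s L \<subseteq> \<pi> ` filt n J L"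
    using gen_filt[OF free_Z free_b assms] by auto
  then have "(\<lambda>a. \<pi> (gen r Z b a)) ` idx r d s L \<subseteq> mp.span (\<pi> ` filt n J L)"
    using mp.span_superset by (rule order_trans)
  then have "mp.span (\<pi> ` filt n J L) = mp.span ((\<lambda>a. \<pi> (gen r Z b a)) ` idx r d s L)"
    using free_span[of L] unfolding mp.span_eq image_image by (intro conjI)
  then show ?thesis unfolding free_dim[symmetric] by (rule mp.span_eq_dim)
qed

end

end

subsection \<open>Deforming the linear forms\<close>

lemma constant_power: "Poly_Mapping.single 0 c ^ k = Poly_Mapping.single (0 :: 'a::monoid_add) (c ^ k)"
  by (induction k) (simp_all add: mult_single)

lemma poly_at_constant:
  fixes P :: "'k::field mpoly poly"
  assumes "degree P \<le> N"
  shows "poly P (Poly_Mapping.single 0 t) = (\<Sum>k\<le>N. cscale (t ^ k) (coeff P k))"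
proof -
  have "poly P (Poly_Mapping.single 0 t) = (\<Sum>k\<le>degree P. cscale (t ^ k) (coeff P k))"
    unfolding poly_altdef constant_power by (simp add: cscale_def mult.commute)
  also have "\<dots> = (\<Sum>k\<le>N. cscale (t ^ k) (coeff P k))"
    by (rule sum.mono_neutral_left) (use assms in \<open>auto simp: coeff_eq_0\<close>)
  finally show ?thesis .
qed

text \<open>The parameter is given degree \<open>0\<close>: all coefficients are forms of the same
  degree.\<close>

definition homog_coeffs :: "nat \<Rightarrow> nat \<Rightarrow> 'k::field mpoly poly set" where
  "homog_coeffs n e = {P. \<forall>k. coeff P k \<in> homog n (int e)}"

lemma homog_coeffs_mpow:
  fixes Z W :: "nat \<Rightarrow> 'k::field mpoly"
  assumes "\<And>p. p < r \<Longrightarrow> Z p \<in> homog n 1" "\<And>p. p < r \<Longrightarrow> W p \<in> homog n 1"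
    and "Poly_Mapping.keys t \<subseteq> {..<r}"
  shows "mpow r (\<lambda>p. [:Z p, W p:]) t \<in> homog_coeffs n (mon_degree t)"
proof (rule mpow_graded)
  show "(1 :: 'k mpoly poly) \<in> homog_coeffs n 0"
    by (simp add: homog_coeffs_def one_in_homog mp.subspace_0[OF subspace_homog])
  show "P * Q \<in> homog_coeffs n (k + l)" if "P \<in> homog_coeffs n k" "Q \<in> homog_coeffs n l"
    for k l and P Q :: "'k mpoly poly"
    unfolding homog_coeffs_def mem_Collect_eq coeff_mult of_nat_add using that
    by (intro allI mp.subspace_sum[OF subspace_homog] homog_mult) (simp_all add: homog_coeffs_def)
  show "[:Z p, W p:] \<in> homog_coeffs n 1" if "p < r" for p
    using assms(1,2)[OF that] mp.subspace_0[OF subspace_homog[of n 1]]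
    by (auto simp: homog_coeffs_def coeff_pCons split: nat.split)
qed fact

context graded_quotient
begin

text \<open>One degree bound at a time, the pieces are finite-dimensional and the determinant
  argument applies. Its hypothesis holds because every coefficient in \<open>t\<close> of a deformed
  generator again lies in \<open>J\<close> with the same degree, hence in the span of the original
  generators.\<close>

lemma deform_base:
  assumes free: "free_on J r Z d s b" and J: "absorbing n J"
    and W: "\<And>p. p < r \<Longrightarrow> W p \<in> homog n 1"
  shows "finite {t. \<not> \<pi> ` filt n J L
    \<subseteq> mp.span (\<pi> ` gen r (\<lambda>p. Z p + cscale t (W p)) b ` idx r d s L)}"
proof -
  \<comment> \<open>The generator \<open>a\<close> with each form \<open>Z p\<close> replaced by
    \<open>Z p + T * W p\<close>, where \<open>T\<close> is the parameter as an
    indeterminate.\<close>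
  define P where "P a = (case a of (i, t) \<Rightarrow> mpow r (\<lambda>p. [:Z p, W p:]) t * [:b i:])" for a
  define N where "N = (\<Sum>a\<in>idx r d s L. degree (P a))"
  define u where "u a k = \<pi> (coeff (P a) k)" for a k
  define Zt where "Zt t p = Z p + cscale t (W p)" for t p
  have P_eval: "poly (P a) (Poly_Mapping.single 0 t) = gen r (Zt t) b a" for a t
  proof -
    have "(\<lambda>p. poly [:Z p, W p:] (Poly_Mapping.single 0 t)) = Zt t"
      by (simp add: Zt_def fun_eq_iff cscale_def)
    then show ?thesis by (simp add: P_def split_def gen_def poly_mpow)
  qed
  have u0: "u a 0 = \<pi> (gen r Z b a)" for a
  proof -
    have "coeff (P a) 0 = poly (P a) (Poly_Mapping.single 0 0)"
      by (simp add: poly_0_coeff_0)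
    also have "\<dots> = gen r Z b a"
      unfolding P_eval by (rule arg_cong[of _ _ "\<lambda>Z. gen r Z b a"]) (simp add: Zt_def fun_eq_iff)
    finally show ?thesis by (simp add: u_def)
  qed
  have v: "(\<Sum>k\<le>N. cscale (t ^ k) (u a k)) = \<pi> (gen r (Zt t) b a)" if "a \<in> idx r d s L" for a t
  proof -
    have "degree (P a) \<le> N"
      unfolding N_def using that by (intro member_le_sum) auto
    from arg_cong[OF poly_at_constant[OF this, of t], of \<pi>] show ?thesis
      by (simp add: P_eval u_def l.sum l.scale)
  qed
  have "finite {t. \<not> (\<lambda>a. u a 0) ` idx r d s L
      \<subseteq> mp.span ((\<lambda>a. \<Sum>k\<le>N. cscale (t ^ k) (u a k)) ` idx r d s L)}"
  proof (rule mp.finite_degenerate_parameters)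
    show "mp.dim ((\<lambda>a. u a 0) ` idx r d s L) = card (idx r d s L)"
      unfolding u0 by (rule free_dim[OF free])
    fix a k assume "a \<in> idx r d s L"
    then obtain i t where it: "a = (i, t)" "i < d" "Poly_Mapping.keys t \<subseteq> {..<r}"
      "mon_degree t + s i \<le> L"
      by (auto simp: idx_def)
    have "coeff (mpow r (\<lambda>p. [:Z p, W p:]) t) k \<in> homog n (int (mon_degree t))"
      using homog_coeffs_mpow[OF free_Z[OF free] W it(3)] by (simp add: homog_coeffs_def)
    moreover have "b i \<in> J" "b i \<in> homog n (int (s i))"
      using free_b[OF free it(2)] by simp_all
    ultimately have "coeff (mpow r (\<lambda>p. [:Z p, W p:]) t) k * b i \<in> filt n J L"
      using homog_mult_absorbing[OF J] it(4) by (intro filtI[where l = "mon_degree t + s i"])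
    moreover have "coeff (P a) k = coeff (mpow r (\<lambda>p. [:Z p, W p:]) t) k * b i"
      by (simp add: P_def it(1) mult.commute)
    ultimately have "u a k \<in> \<pi> ` filt n J L" unfolding u_def by simp
    then show "u a k \<in> mp.span ((\<lambda>a. u a 0) ` idx r d s L)"
      using free_span[OF free, of L] unfolding u0 image_image by (rule rev_subsetD)
  qed simp
  moreover have "\<pi> ` filt n J L \<subseteq> mp.span (\<pi> ` gen r (Zt t) b ` idx r d s L)"
    if "(\<lambda>a. u a 0) ` idx r d s L
      \<subseteq> mp.span ((\<lambda>a. \<Sum>k\<le>N. cscale (t ^ k) (u a k)) ` idx r d s L)" for t
  proof -
    have "(\<lambda>a. \<Sum>k\<le>N. cscale (t ^ k) (u a k)) ` idx r d s L = \<pi> ` gen r (Zt t) b ` idx r d s L"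
      unfolding image_image using v by (rule image_cong[OF refl])
    with that have "\<pi> ` gen r Z b ` idx r d s L \<subseteq> mp.span (\<pi> ` gen r (Zt t) b ` idx r d s L)"
      unfolding u0 by (simp add: image_image)
    then have "mp.span (\<pi> ` gen r Z b ` idx r d s L)
        \<subseteq> mp.span (\<pi> ` gen r (Zt t) b ` idx r d s L)"
      using mp.subspace_span by (rule mp.span_minimal)
    with free_span[OF free] show ?thesis by (rule order_trans)
  qed
  ultimately show ?thesis unfolding Zt_def
    by (elim rev_finite_subset) (intro Collect_mono impI notI, erule notE)
qed

text \<open>Finitely many degrees decide. In high degree every generator over \<open>Z\<close> has a
  factor \<open>Z p\<close>; the rest is, by induction, a combination of products of the
  \<open>Z'\<close> with the \<open>b i\<close>. So it is enough that multiplication by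
  \<open>Z p\<close> preserves such combinations, up to one degree more.\<close>

lemma deform_step:
  assumes free: "free_on J r Z d s b" and J: "absorbing n J"
    and Z': "\<And>p. p < r \<Longrightarrow> Z' p \<in> homog n 1"
    and D: "\<And>i. i < d \<Longrightarrow> s i \<le> D"
    and base: "\<And>L. L \<le> D + 1 \<Longrightarrow> \<pi> ` filt n J L \<subseteq> mp.span (\<pi> ` gen r Z' b ` idx r d s L)"
  shows "\<pi> ` filt n J L \<subseteq> mp.span (\<pi> ` gen r Z' b ` idx r d s L)"
proof (induction L)
  case 0
  show ?case by (rule base) simp
next
  case (Suc L)
  show ?case
  proof (cases "Suc L \<le> D + 1")
    case True
    then show ?thesis by (rule base)
  next
    case False
    \<comment> \<open>The bound \<open>D + 1\<close> leaves room for every product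
      \<open>Z p * b i\<close>, of degree at most \<open>D + 1\<close>, to be covered by the
      induction hypothesis.\<close>
    then have L: "D + 1 \<le> L" by simp
    define T where "T = mp.span (\<pi> ` gen r Z' b ` idx r d s (Suc L))"
    have T: "mp.subspace T" unfolding T_def by simp
    have IH: "\<pi> x \<in> mp.span (\<pi> ` gen r Z' b ` idx r d s L)" if "x \<in> filt n J L" for x
      using Suc that by (rule subsetD[OF _ imageI])
    have mono: "mp.span (\<pi> ` gen r Z' b ` idx r d s L) \<subseteq> T"
      unfolding T_def by (intro mp.span_mono image_mono idx_mono) simp_all
    have carr: "Z p \<in> carrier (mpoly_ring n)" "Z' p \<in> carrier (mpoly_ring n)" if "p < r" for p
      using homog_subset_carrier free_Z[OF free that] Z'[OF that] by (auto simp: subset_eq)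
    have closed': "\<pi> (Z' q * x) \<in> T"
      if q: "q < r" and x: "\<pi> x \<in> mp.span (\<pi> ` gen r Z' b ` idx r d s L)" for q x
    proof (rule mult_in_subspace[OF carr(2)[OF q] x T])
      fix y assume "y \<in> gen r Z' b ` idx r d s L"
      then obtain i t where y: "y = gen r Z' b (i, t)" and it: "(i, t) \<in> idx r d s L" by auto
      let ?t = "t + Poly_Mapping.single q 1"
      have "Z' q * y = gen r Z' b (i, ?t)"
        unfolding y gen_eq mpow_add mpow_single[OF q] by (simp add: ac_simps)
      moreover have "Poly_Mapping.keys ?t \<subseteq> Poly_Mapping.keys t \<union> {q}"
        using Poly_Mapping.keys_add[of t "Poly_Mapping.single q 1"] by simp
      then have "(i, ?t) \<in> idx r d s (Suc L)"
        using it q unfolding mem_idx by auto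
      ultimately show "\<pi> (Z' q * y) \<in> T"
        unfolding T_def by (simp add: mp.span_base)
    qed
    \<comment> \<open>\<open>Z p\<close> is exchanged with a factor \<open>Z' q\<close>: without
      that factor the product has degree at most \<open>L\<close> and is covered by induction, and
      multiplying by \<open>Z' q\<close> is harmless by \<open>closed'\<close>.\<close>
    have closed: "\<pi> (Z p * x) \<in> T"
      if p: "p < r" and x: "\<pi> x \<in> mp.span (\<pi> ` gen r Z' b ` idx r d s L)" for p x
    proof (rule mult_in_subspace[OF carr(1)[OF p] x T])
      fix y assume "y \<in> gen r Z' b ` idx r d s L"
      then obtain i t where y: "y = gen r Z' b (i, t)" and it: "(i, t) \<in> idx r d s L" by auto
      have i: "i < d" and t: "Poly_Mapping.keys t \<subseteq> {..<r}" and deg: "mon_degree t + s i \<le> L"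
        using it by (simp_all add: mem_idx)
      have b: "b i \<in> J" "b i \<in> homog n (int (s i))" using free_b[OF free i] by simp_all
      have Zp: "Z p \<in> homog n (int 1)" using free_Z[OF free p] by simp
      show "\<pi> (Z p * y) \<in> T"
        using t
      proof (cases rule: exponent_cases)
        case 1
        have "Z p * b i \<in> filt n J L"
          using homog_mult_absorbing[OF J Zp b] D[OF i] L
          by (intro filtI[where l = "1 + s i"]) simp_all
        then show ?thesis using IH mono by (simp add: y 1 gen_eq subset_eq)
      next
        case (2 q t')
        have "mpow r Z' t' * b i \<in> J" "mpow r Z' t' * b i \<in> homog n (int (mon_degree t' + s i))"
          using homog_mult_absorbing[OF J mpow_homog[OF Z' 2(2)] b] by simp_all
        then have "Z p * (mpow r Z' t' * b i) \<in> filt n J L"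
          using homog_mult_absorbing[OF J Zp, of "mpow r Z' t' * b i" "mon_degree t' + s i"] deg 2(3)
          by (intro filtI[where l = "1 + (mon_degree t' + s i)"]) simp_all
        from closed'[OF 2(1) IH[OF this]] show ?thesis
          unfolding y gen_eq 2(3) mpow_add mpow_single[OF 2(1)] by (simp add: ac_simps)
      qed
    qed
    have "\<pi> ` gen r Z b ` idx r d s (Suc L) \<subseteq> T"
      unfolding image_image
    proof (rule image_subsetI)
      fix a assume "a \<in> idx r d s (Suc L)"
      then obtain i t where a: "a = (i, t)" and i: "i < d" and t: "Poly_Mapping.keys t \<subseteq> {..<r}"
        and deg: "mon_degree t + s i \<le> Suc L"
        by (auto simp: idx_def)
      show "\<pi> (gen r Z b a) \<in> T"
        using t
      proof (cases rule: exponent_cases)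
        case 1
        have "b i \<in> filt n J L"
          using free_b[OF free i] D[OF i] L by (intro filtI[where l = "s i"]) simp_all
        then show ?thesis using IH mono by (simp add: a 1 gen_eq subset_eq)
      next
        case (2 p t')
        have "(i, t') \<in> idx r d s L" using i 2(2,3) deg by (simp add: mem_idx)
        from closed[OF 2(1) IH[OF gen_filt[OF free_Z[OF free] free_b[OF free] J this]]]
        show ?thesis
          unfolding a gen_eq 2(3) mpow_add mpow_single[OF 2(1)] by (simp add: ac_simps)
      qed
    qed
    then have "mp.span (\<pi> ` gen r Z b ` idx r d s (Suc L)) \<subseteq> T"
      using T by (rule mp.span_minimal)
    with free_span[OF free] show ?thesis unfolding T_def by (rule order_trans)
  qed
qed

text \<open>Each degree up to \<open>D + 1\<close> excludes finitely many parameters, and a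
  parameter that survives them survives in all degrees.\<close>

lemma deform:
  assumes free: "free_on J r Z d s b" and J: "absorbing n J"
    and W: "\<And>p. p < r \<Longrightarrow> W p \<in> homog n 1"
  shows "finite {t. \<exists>L. \<not> \<pi> ` filt n J L
    \<subseteq> mp.span (\<pi> ` gen r (\<lambda>p. Z p + cscale t (W p)) b ` idx r d s L)}" (is "finite ?B")
proof -
  define D where "D = (\<Sum>i<d. s i)"
  have D: "s i \<le> D" if "i < d" for i
    unfolding D_def using that by (intro member_le_sum) auto
  define B where "B L = {t. \<not> \<pi> ` filt n J L
    \<subseteq> mp.span (\<pi> ` gen r (\<lambda>p. Z p + cscale t (W p)) b ` idx r d s L)}" for L
  have "?B \<subseteq> (\<Union>L\<le>D + 1. B L)"
  proof (rule subsetI, rule ccontr)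
    fix t assume t: "t \<in> ?B" "t \<notin> (\<Union>L\<le>D + 1. B L)"
    have "Z p + cscale t (W p) \<in> homog n 1" if "p < r" for p
      using free_Z[OF free that] W[OF that]
      by (intro mp.subspace_add[OF subspace_homog] mp.subspace_scale[OF subspace_homog])
    from deform_step[OF free J this D] t show False by (auto simp: B_def)
  qed
  moreover have "finite (\<Union>L\<le>D + 1. B L)"
    unfolding B_def by (intro finite_UN_I deform_base[OF free J W]) simp_all
  ultimately show ?thesis by (rule finite_subset)
qed

end

subsection \<open>Comparison of the shifts\<close>

text \<open>The subring generated over \<open>k\<close> by the \<open>Z p\<close>, written as a span
  so that linear algebra applies to it directly.\<close>

definition mono_span :: "nat \<Rightarrow> (nat \<Rightarrow> 'k::field mpoly) \<Rightarrow> 'k mpoly set" where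
  "mono_span r Z = mp.span (mpow r Z ` {t. Poly_Mapping.keys t \<subseteq> {..<r}})"

lemma mpow_in_mono_span: "Poly_Mapping.keys t \<subseteq> {..<r} \<Longrightarrow> mpow r Z t \<in> mono_span r Z"
  unfolding mono_span_def by (intro mp.span_base imageI) simp

lemma one_in_mono_span: "1 \<in> mono_span r Z"
  using mpow_in_mono_span[of 0 r Z] by simp

lemma subspace_mono_span: "mp.subspace (mono_span r Z)"
  unfolding mono_span_def by simp

lemma mono_span_mult:
  assumes "x \<in> mono_span r Z" "y \<in> mono_span r Z"
  shows "x * y \<in> mono_span r Z"
  using assms(1) unfolding mono_span_def[of r Z]
proof (induction rule: mp.span_induct_alt)
  case base
  show ?case by (simp add: mp.span_zero)
next
  case (step c p q)
  from step(1) obtain t where t: "p = mpow r Z t" "Poly_Mapping.keys t \<subseteq> {..<r}" by auto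
  have "p * y \<in> mono_span r Z"
    using assms(2) unfolding mono_span_def[of r Z]
  proof (induction rule: mp.span_induct_alt)
    case base
    show ?case by (simp add: mp.span_zero)
  next
    case (step c x y)
    from step(1) obtain u where u: "x = mpow r Z u" "Poly_Mapping.keys u \<subseteq> {..<r}" by auto
    have "Poly_Mapping.keys (t + u) \<subseteq> {..<r}"
      using Poly_Mapping.keys_add[of t u] t(2) u(2) by (meson Un_least order_trans)
    from mpow_in_mono_span[OF this, of Z] have "p * x \<in> mono_span r Z"
      by (simp add: t u mpow_add)
    then show ?case using step(2) unfolding mono_span_def[of r Z]
      by (simp add: distrib_left mp.span_add mp.span_scale)
  qed
  then show ?case using step(2) unfolding mono_span_def[of r Z]
    by (simp add: distrib_right mp.span_add mp.span_scale)
qed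

lemma mono_span_subset:
  assumes "mp.subspace V" "\<And>t. Poly_Mapping.keys t \<subseteq> {..<r} \<Longrightarrow> mpow r Z t \<in> V"
  shows "mono_span r Z \<subseteq> V"
  unfolding mono_span_def by (rule mp.span_minimal) (use assms in auto)

lemma mono_span_carrier:
  assumes "\<And>p. p < r \<Longrightarrow> Z p \<in> homog n 1"
  shows "mono_span r Z \<subseteq> carrier (mpoly_ring n)"
  by (rule mono_span_subset[OF subspace_carrier])
    (rule subsetD[OF homog_subset_carrier mpow_homog[OF assms]])

context graded_quotient
begin

lemma subspace_I: "mp.subspace I"
proof -
  have "I = {x. \<pi> x = 0}" using kernel by simp
  then show ?thesis by (simp add: l.subspace_kernel)
qed

lemma free_mono_span:
  assumes "free_on J r Z d s b" "\<And>i. i < d \<Longrightarrow> \<rho> i \<in> mono_span r Z"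
    and "(\<Sum>i<d. \<rho> i * b i) \<in> I" "i < d"
  shows "\<rho> i = 0"
  using free_coeffs[OF assms(1), of \<rho>] assms(2-) unfolding mono_span_def by simp

lemma free_dim_le:
  assumes "free_on J r Z d s b" "A \<subseteq> \<pi> ` filt n J L"
  shows "mp.dim A \<le> card (idx r d s L)"
proof -
  have "A \<subseteq> mp.span ((\<lambda>a. \<pi> (gen r Z b a)) ` idx r d s L)"
    using assms(2) free_span[OF assms(1)] unfolding image_image by (rule order_trans)
  from mp.dim_mono_finite[OF this] show ?thesis
    unfolding free_dim[OF assms(1)] by simp
qed

context
  fixes J1 J2 r1 r2 Z1 Z2 d1 d2 s1 s2 b1 b2
  assumes free1: "free_on J1 r1 Z1 d1 s1 b1" and free2: "free_on J2 r2 Z2 d2 s2 b2"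
    and J1: "absorbing n J1" and sub: "J1 \<subseteq> J2"
begin

text \<open>The multiples of the single generator \<open>b1 0\<close> already grow like a polynomial
  ring in \<open>r1\<close> variables, and they have to fit into \<open>d2\<close> copies of one in
  \<open>r2\<close> variables.\<close>

lemma vars_le:
  assumes "d1 > 0"
  shows "r1 \<le> r2"
proof (rule card_mons_growth_le)
  fix L
  have "card (mons r1 L) \<le> card (idx r1 1 s1 (L + s1 0))"
    using card_idx_ge[of 1 s1 "s1 0" r1 L] by simp
  also have "\<dots> \<le> card (idx r1 d1 s1 (L + s1 0))"
    using assms by (intro card_mono idx_mono) simp_all
  also have "\<dots> = mp.dim (\<pi> ` filt n J1 (L + s1 0))"
    by (rule free_hilbert[OF free1 J1, symmetric])
  also have "\<dots> \<le> card (idx r2 d2 s2 (L + s1 0))"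
    by (intro free_dim_le[OF free2] image_mono filt_mono sub) simp
  also have "\<dots> \<le> d2 * card (mons r2 (L + s1 0))" by (rule card_idx_le)
  finally show "card (mons r1 L) \<le> d2 * card (mons r2 (L + s1 0))" .
qed

text \<open>A nonzero \<open>x\<close> in \<open>J1/I\<close> is torsion-free over the polynomial ring acting freely on \<open>J2/I\<close>,
  and its multiples lie in \<open>J1/I\<close> because \<open>J1\<close> is an ideal.\<close>

lemma vars_ge:
  assumes "d1 > 0"
  shows "r2 \<le> r1"
proof (rule card_mons_growth_le)
  fix L
  define x where "x = b1 0"
  have x: "x \<in> J1" "x \<in> homog n (int (s1 0))"
    using free_b[OF free1 assms] by (simp_all add: x_def)
  have "x \<notin> I"
  proof
    assume "x \<in> I"
    define \<rho> where "\<rho> i = (if i = 0 then 1 else 0 :: 'k mpoly)" for i :: nat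
    have "(\<Sum>i<d1. \<rho> i * b1 i) = (\<Sum>i<d1. if i = 0 then b1 i else 0)"
      by (rule sum.cong) (auto simp: \<rho>_def)
    also have "\<dots> = x" using assms by (simp add: x_def)
    finally have "(\<Sum>i<d1. \<rho> i * b1 i) \<in> I" using \<open>x \<in> I\<close> by simp
    moreover have "\<rho> i \<in> mono_span r1 Z1" for i
      by (simp add: \<rho>_def mp.subspace_0[OF subspace_mono_span] one_in_mono_span)
    ultimately have "\<rho> 0 = 0" by (intro free_mono_span[OF free1 _ _ assms])
    then show False by (simp add: \<rho>_def)
  qed
  have "\<pi> x \<in> mp.span ((\<lambda>a. \<pi> (gen r2 Z2 b2 a)) ` idx r2 d2 s2 (s1 0))"
    using subsetD[OF free_span[OF free2] imageI[OF filtI[OF subsetD[OF sub x(1)] x(2) order_refl]]]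
    by (simp add: image_image)
  from mp.span_family[OF this finite_idx] obtain c where
    c: "\<pi> x = (\<Sum>a\<in>idx r2 d2 s2 (s1 0). cscale (c a) (\<pi> (gen r2 Z2 b2 a)))" by auto
  define T where "T i = {t. Poly_Mapping.keys t \<subseteq> {..<r2} \<and> mon_degree t + s2 i \<le> s1 0}" for i
  have finT: "finite (T i)" for i
    unfolding T_def by (rule finite_subset[OF idx_subset_mons finite_mons])
  \<comment> \<open>The coordinates of \<open>x\<close> in the basis \<open>b2\<close>. One of them
    is nonzero modulo nothing but \<open>0\<close>, and since polynomials form a domain,
    \<open>E * x \<in> I\<close> then forces \<open>E = 0\<close>.\<close>
  define \<rho> where "\<rho> i = (\<Sum>t\<in>T i. cscale (c (i, t)) (mpow r2 Z2 t))" for i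
  have \<rho>: "\<rho> i \<in> mono_span r2 Z2" for i
    unfolding \<rho>_def
    by (intro mp.subspace_sum[OF subspace_mono_span] mp.subspace_scale[OF subspace_mono_span]
        mpow_in_mono_span) (simp add: T_def)
  have "(\<Sum>i<d2. \<rho> i * b2 i) = (\<Sum>a\<in>idx r2 d2 s2 (s1 0). cscale (c a) (gen r2 Z2 b2 a))"
    unfolding idx_def \<rho>_def T_def[symmetric] sum_distrib_right
    by (subst sum.Sigma) (simp_all add: finT gen_eq split_def gen_def)
  then have "\<pi> ((\<Sum>i<d2. \<rho> i * b2 i) - x) = 0"
    by (simp add: c l.diff l.sum l.scale)
  then have diff: "(\<Sum>i<d2. \<rho> i * b2 i) - x \<in> I" by (simp only: kernel)
  have "\<exists>i<d2. \<rho> i \<noteq> 0"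
  proof (rule ccontr)
    assume "\<not> (\<exists>i<d2. \<rho> i \<noteq> 0)"
    then have "- x \<in> I" using diff by simp
    then show False using \<open>x \<notin> I\<close> mp.subspace_neg[OF subspace_I, of "- x"] by simp
  qed
  then obtain j where j: "j < d2" "\<rho> j \<noteq> 0" by blast
  have "mp.dim ((\<lambda>t. \<pi> (mpow r2 Z2 t * x)) ` mons r2 L) = card (mons r2 L)"
    unfolding mp.dim_image_eq_card_iff[OF finite_mons]
  proof (rule allI, rule impI)
    fix e assume e: "(\<Sum>t\<in>mons r2 L. cscale (e t) (\<pi> (mpow r2 Z2 t * x))) = 0"
    define E where "E = (\<Sum>t\<in>mons r2 L. cscale (e t) (mpow r2 Z2 t))"
    have E: "E \<in> mono_span r2 Z2"
      unfolding E_def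
      by (intro mp.subspace_sum[OF subspace_mono_span] mp.subspace_scale[OF subspace_mono_span]
          mpow_in_mono_span) (simp add: mons_def)
    have "\<pi> (E * x) = 0"
      using e by (simp add: E_def sum_distrib_right l.sum l.scale)
    then have Ex: "E * x \<in> I" by (simp only: kernel)
    have "E \<in> carrier (mpoly_ring n)"
      using mono_span_carrier[OF free_Z[OF free2]] E by (rule subsetD)
    from mp.subspace_add[OF subspace_I absorbingD[OF absorb this diff] Ex]
    have "E * (\<Sum>i<d2. \<rho> i * b2 i) \<in> I" by (simp add: right_diff_distrib)
    then have "(\<Sum>i<d2. (E * \<rho> i) * b2 i) \<in> I"
      by (simp add: sum_distrib_left mult.assoc)
    then have "E * \<rho> j = 0"
      by (rule free_mono_span[OF free2 mono_span_mult[OF E \<rho>] _ j(1)])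
    then have "E = 0" using j(2) by simp
    then show "\<forall>t\<in>mons r2 L. e t = 0"
      using free_mons[OF free2, of L] unfolding mp.dim_image_eq_card_iff[OF finite_mons] E_def
      by (elim allE[of _ e] mp)
  qed
  then have "card (mons r2 L) = mp.dim ((\<lambda>t. \<pi> (mpow r2 Z2 t * x)) ` mons r2 L)" by simp
  also have "\<dots> \<le> card (idx r1 d1 s1 (L + s1 0))"
  proof (rule free_dim_le[OF free1], rule image_subsetI, rule imageI)
    fix t assume t: "t \<in> mons r2 L"
    then have "mpow r2 Z2 t \<in> homog n (int (mon_degree t))"
      by (intro mpow_homog free_Z[OF free2]) (simp_all add: mons_def)
    from homog_mult_absorbing[OF J1 this x] show "mpow r2 Z2 t * x \<in> filt n J1 (L + s1 0)"
      by (rule filtI) (use t in \<open>simp add: mons_def\<close>)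
  qed
  also have "\<dots> \<le> d1 * card (mons r1 (L + s1 0))" by (rule card_idx_le)
  finally show "card (mons r2 L) \<le> d1 * card (mons r1 (L + s1 0))" .
qed

end

text \<open>Once both modules are free over the same forms, degrees decide: below degree
  \<open>s2 i\<close> only the generators \<open>b2 k\<close> with \<open>k < i\<close> can occur,
  so \<open>s1 i < s2 i\<close> would push the first \<open>i + 1\<close> generators of the smaller
  module into a free module of rank \<open>i\<close>.\<close>

lemma shifts_le:
  assumes free1: "free_on J1 r1 Z1 d1 s1 b1" and free2: "free_on J2 r2 Z2 d2 s2 b2"
    and J1: "absorbing n J1" and J2: "absorbing n J2" and sub: "J1 \<subseteq> J2"
    and inf: "infinite (UNIV :: 'k set)"
    and s1: "\<And>j. j \<le> i \<Longrightarrow> s1 j \<le> s1 i" and s2: "\<And>j. i \<le> j \<Longrightarrow> j < d2 \<Longrightarrow> s2 i \<le> s2 j"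
    and i: "i < d1"
  shows "s2 i \<le> s1 i"
proof (rule ccontr)
  assume "\<not> s2 i \<le> s1 i"
  then have less: "s1 i < s2 i" by simp
  have r: "r1 = r2"
    using vars_le[OF free1 free2 J1 sub] vars_ge[OF free1 free2 J1 sub] i by simp
  define W where "W p = Z1 p - Z2 p" for p
  \<comment> \<open>This line runs from \<open>Z2\<close> at \<open>t = 0\<close> to
    \<open>Z1\<close> at \<open>t = 1\<close>. Seen from \<open>Z1\<close>, the same point has
    parameter \<open>1 - t\<close> and direction \<open>- W\<close>, which is why the exceptional
    set \<open>B1\<close> is reflected below.\<close>
  define Zt where "Zt t p = Z2 p + cscale t (W p)" for t p
  have W: "W p \<in> homog n 1" if "p < r2" for p
    unfolding W_def using free_Z[OF free1] free_Z[OF free2] that r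
    by (intro mp.subspace_diff[OF subspace_homog]) simp_all
  have Wneg: "- W p \<in> homog n 1" if "p < r1" for p
    using W that r by (intro mp.subspace_neg[OF subspace_homog]) simp
  define B1 where "B1 = {t. \<exists>L. \<not> \<pi> ` filt n J1 L
    \<subseteq> mp.span (\<pi> ` gen r1 (\<lambda>p. Z1 p + cscale t (- W p)) b1 ` idx r1 d1 s1 L)}"
  define B2 where "B2 = {t. \<exists>L. \<not> \<pi> ` filt n J2 L
    \<subseteq> mp.span (\<pi> ` gen r2 (Zt t) b2 ` idx r2 d2 s2 L)}"
  have "finite B1" unfolding B1_def by (rule deform[OF free1 J1 Wneg])
  moreover have "finite B2" unfolding B2_def Zt_def by (rule deform[OF free2 J2 W])
  ultimately have "finite ((\<lambda>t. 1 - t) ` B1 \<union> B2)" by simp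
  from ex_new_if_finite[OF inf this] obtain t where t: "1 - t \<notin> B1" "t \<notin> B2"
    by (auto simp: image_iff) (metis add_diff_cancel_left' diff_add_cancel)
  have "(\<lambda>p. Z1 p + cscale (1 - t) (- W p)) = Zt t"
    by (simp add: fun_eq_iff Zt_def W_def algebra_simps mp.scale_right_diff_distrib
        mp.scale_left_diff_distrib)
  with t(1) have span1: "\<pi> ` filt n J1 L \<subseteq> mp.span (\<pi> ` gen r2 (Zt t) b1 ` idx r2 d1 s1 L)" for L
    by (simp add: B1_def r)
  from t(2) have span2: "\<pi> ` filt n J2 L \<subseteq> mp.span (\<pi> ` gen r2 (Zt t) b2 ` idx r2 d2 s2 L)" for L
    by (simp add: B2_def)
  have Zt: "Zt t p \<in> homog n 1" if "p < r2" for p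
    unfolding Zt_def using free_Z[OF free2 that] W[OF that]
    by (intro mp.subspace_add[OF subspace_homog] mp.subspace_scale[OF subspace_homog])
  let ?f = "\<lambda>a. \<pi> (gen r2 (Zt t) b1 a)"
  let ?g = "\<lambda>a. \<pi> (gen r2 (Zt t) b2 a)"
  \<comment> \<open>The deformed family spans a space whose dimension equals the number of its
    members, so it is independent.\<close>
  have dim1: "mp.dim (?f ` idx r2 d1 s1 L) = card (idx r2 d1 s1 L)" for L
  proof (rule antisym)
    have "card (idx r2 d1 s1 L) = mp.dim (\<pi> ` filt n J1 L)"
      using free_hilbert[OF free1 J1] r by simp
    also have "\<dots> \<le> mp.dim (?f ` idx r2 d1 s1 L)"
      by (rule mp.dim_mono_finite) (use span1[of L] in \<open>simp_all add: image_image\<close>)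
    finally show "card (idx r2 d1 s1 L) \<le> mp.dim (?f ` idx r2 d1 s1 L)" .
  qed (rule mp.dim_image_le_card[OF finite_idx])
  \<comment> \<open>Independent elements on the left, counted inside a span with as many generators
    as the right-hand index set has elements.\<close>
  have key: "card (idx r2 (Suc i) s1 L) \<le> card (idx r2 i s2 L)" for L
  proof -
    have "idx r2 (Suc i) s1 L \<subseteq> idx r2 d1 s1 L" using i by (intro idx_mono) simp_all
    then have "card (idx r2 (Suc i) s1 L) = mp.dim (?f ` idx r2 (Suc i) s1 L)"
      by (rule mp.dim_image_eq_card_subset[OF finite_idx dim1, symmetric])
    also have "\<dots> \<le> mp.dim (?g ` idx r2 i s2 L)"
    proof (rule mp.dim_mono_finite, rule image_subsetI)
      fix a assume "a \<in> idx r2 (Suc i) s1 L"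
      then obtain j u where a: "a = (j, u)" and j: "j \<le> i" and u: "Poly_Mapping.keys u \<subseteq> {..<r2}"
        and deg: "mon_degree u + s1 j \<le> L"
        by (auto simp: idx_def)
      have "j < d1" using i j by simp
      then have "b1 j \<in> J2" "b1 j \<in> homog n (int (s1 j))"
        using free_b[OF free1] sub by auto
      then have "b1 j \<in> filt n J2 (s1 j)" by (rule filtI) simp
      with span2 have bj: "\<pi> (b1 j) \<in> mp.span (\<pi> ` gen r2 (Zt t) b2 ` idx r2 d2 s2 (s1 j))"
        by (rule subsetD[OF _ imageI])
      have "mpow r2 (Zt t) u \<in> carrier (mpoly_ring n)"
        by (rule subsetD[OF homog_subset_carrier mpow_homog[OF Zt u]])
      then have "\<pi> (mpow r2 (Zt t) u * b1 j) \<in> mp.span (?g ` idx r2 i s2 L)"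
      proof (rule mult_in_subspace[OF _ bj mp.subspace_span])
        fix y assume "y \<in> gen r2 (Zt t) b2 ` idx r2 d2 s2 (s1 j)"
        then obtain k v where y: "y = mpow r2 (Zt t) v * b2 k" and k: "k < d2"
          and v: "Poly_Mapping.keys v \<subseteq> {..<r2}" and deg': "mon_degree v + s2 k \<le> s1 j"
          by (auto simp: idx_def gen_eq)
        have "k < i"
        proof (rule ccontr)
          assume "\<not> k < i"
          then have "s2 i \<le> s2 k" using s2[OF _ k] by simp
          then show False using less deg' s1[OF j] by simp
        qed
        moreover have "Poly_Mapping.keys (u + v) \<subseteq> {..<r2}"
          using Poly_Mapping.keys_add[of u v] u v by (meson Un_least order_trans)
        ultimately have "(k, u + v) \<in> idx r2 i s2 L"
          using deg deg' by (simp add: mem_idx)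
        then have "?g (k, u + v) \<in> mp.span (?g ` idx r2 i s2 L)"
          by (intro mp.span_base imageI)
        then show "\<pi> (mpow r2 (Zt t) u * y) \<in> mp.span (?g ` idx r2 i s2 L)"
          by (simp add: gen_eq y mpow_add mult.assoc)
      qed
      then show "?f a \<in> mp.span (?g ` idx r2 i s2 L)" by (simp add: a gen_eq)
    qed simp
    also have "\<dots> \<le> card (idx r2 i s2 L)" by (rule mp.dim_image_le_card[OF finite_idx])
    finally show ?thesis .
  qed
  \<comment> \<open>For \<open>j \<le> i\<close> all shifts \<open>s1 j\<close> are at most
    \<open>s1 i\<close>, so passing to degree \<open>L + s1 i\<close> makes room for
    \<open>i + 1\<close> full copies of the monomials up to degree \<open>L\<close>.\<close>
  have "(i + 1) * card (mons r2 L) \<le> i * card (mons r2 (L + s1 i))" for L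
  proof -
    have "(i + 1) * card (mons r2 L) \<le> card (idx r2 (Suc i) s1 (L + s1 i))"
      using card_idx_ge[of "Suc i" s1 "s1 i" r2 L] s1 by simp
    also have "\<dots> \<le> card (idx r2 i s2 (L + s1 i))" by (rule key)
    also have "\<dots> \<le> i * card (mons r2 (L + s1 i))" by (rule card_idx_le)
    finally show ?thesis .
  qed
  from no_exponential_growth[of "\<lambda>L. card (mons r2 L)", OF card_mons_pos card_mons_le this]
  show False .
qed

end

subsection \<open>The subring generated by linear forms\<close>

definition linear_var :: "nat \<Rightarrow> 'k::field mpoly" where
  "linear_var i = Poly_Mapping.single (Poly_Mapping.single i 1) 1"

lemma dim_single_image:
  assumes "finite S"
  shows "mp.dim ((\<lambda>t. Poly_Mapping.single t (1 :: 'k::field)) ` S) = card S"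
  unfolding mp.dim_image_eq_card_iff[OF assms]
proof (intro allI impI ballI)
  fix c :: "_ \<Rightarrow> 'k" and s
  assume 0: "(\<Sum>t\<in>S. cscale (c t) (Poly_Mapping.single t 1)) = 0" and s: "s \<in> S"
  have "Poly_Mapping.lookup (\<Sum>t\<in>S. cscale (c t) (Poly_Mapping.single t 1)) s
      = (\<Sum>t\<in>S. if t = s then c t else 0)"
    unfolding lookup_sum by (rule sum.cong) (auto simp: lookup_single)
  then show "c s = 0" using s assms by (simp add: 0)
qed

lemma inj_linear_var: "inj (linear_var :: nat \<Rightarrow> 'k::field mpoly)"
proof (rule injI)
  fix i j assume "(linear_var i :: 'k mpoly) = linear_var j"
  then have "Poly_Mapping.keys (linear_var i :: 'k mpoly) = Poly_Mapping.keys (linear_var j :: 'k mpoly)"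
    by simp
  then have "Poly_Mapping.keys (Poly_Mapping.single i (1::nat)) = Poly_Mapping.keys (Poly_Mapping.single j (1::nat))"
    by (simp add: linear_var_def)
  then show "i = j" by simp
qed

lemma dim_linear_forms: "mp.dim (homog n 1 :: 'k::field mpoly set) = n + 1"
proof -
  let ?X = "linear_var ` {..n} :: 'k mpoly set"
  have "mp.dim ?X = card ?X"
  proof -
    have "mp.dim ((\<lambda>t. Poly_Mapping.single t (1 :: 'k)) ` (\<lambda>i. Poly_Mapping.single i (1::nat)) ` {..n})
        = card ((\<lambda>i. Poly_Mapping.single i (1::nat)) ` {..n})"
      by (rule dim_single_image) simp
    also have "\<dots> = card {..n}"
    proof (rule card_image, rule inj_onI)
      fix i j assume "Poly_Mapping.single i (1::nat) = Poly_Mapping.single j 1"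
      from arg_cong[OF this, of Poly_Mapping.keys] show "i = j" by simp
    qed
    also have "\<dots> = card ?X"
      by (rule card_image[symmetric]) (rule inj_on_subset[OF inj_linear_var], simp)
    finally show ?thesis by (simp add: image_image linear_var_def)
  qed
  moreover have "card ?X = n + 1"
    by (subst card_image) (simp_all add: inj_on_subset[OF inj_linear_var])
  moreover have "mp.span ?X = mp.span (homog n 1)"
  proof (subst mp.span_eq, intro conjI)
    show "?X \<subseteq> mp.span (homog n 1)"
    proof (rule image_subsetI)
      fix i assume "i \<in> {..n}"
      then have "(linear_var i :: 'k mpoly) \<in> homog n 1"
        by (auto simp: linear_var_def mem_homog)
      then show "(linear_var i :: 'k mpoly) \<in> mp.span (homog n 1)" by (rule mp.span_base)
    qed
    show "homog n 1 \<subseteq> mp.span ?X"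
    proof
      fix p :: "'k mpoly" assume p: "p \<in> homog n 1"
      have "p = (\<Sum>t\<in>Poly_Mapping.keys p. cscale (Poly_Mapping.lookup p t) (Poly_Mapping.single t 1))"
        (is "_ = ?q")
      proof (rule poly_mapping_eqI)
        fix s
        have "Poly_Mapping.lookup ?q s
            = (\<Sum>t\<in>Poly_Mapping.keys p. if t = s then Poly_Mapping.lookup p t else 0)"
          unfolding lookup_sum by (rule sum.cong) (auto simp: lookup_single)
        then show "Poly_Mapping.lookup p s = Poly_Mapping.lookup ?q s"
          by (simp add: in_keys_iff)
      qed
      moreover have "Poly_Mapping.single t 1 \<in> ?X" if "t \<in> Poly_Mapping.keys p" for t
      proof -
        have t: "Poly_Mapping.keys t \<subseteq> {..<Suc n}" "mon_degree t = 1"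
          using p that by (simp_all add: mem_homog lessThan_Suc_atMost)
        from t(1) show ?thesis
        proof (cases rule: exponent_cases)
          case 1
          then show ?thesis using t(2) by simp
        next
          case (2 i s)
          have "mon_degree s = 0" using t(2) 2(3) by simp
          then have "s = 0"
            using lookup_le_mon_degree[of s] by (intro poly_mapping_eqI) simp
          then show ?thesis using 2 by (simp add: linear_var_def)
        qed
      qed
      ultimately show "p \<in> mp.span ?X"
        by (metis (no_types, lifting) mp.span_base mp.span_scale mp.span_sum)
    qed
  qed
  ultimately show ?thesis by (metis mp.span_eq_dim)
qed

lemma span_mons_mult:
  assumes x: "x \<in> mp.span (mpow r Z ` mons r L)" and y: "y \<in> mp.span (Z ` {..<r})"
  shows "x * y \<in> mp.span (mpow r Z ` mons r (Suc L))"
  using x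
proof (induction rule: mp.span_induct_alt)
  case base
  show ?case by (simp add: mp.span_zero)
next
  case (step c x z)
  from step(1) obtain t where t: "x = mpow r Z t" "t \<in> mons r L" by auto
  have "x * y \<in> mp.span (mpow r Z ` mons r (Suc L))"
    using y
  proof (induction rule: mp.span_induct_alt)
    case base
    show ?case by (simp add: mp.span_zero)
  next
    case (step c w y)
    from step(1) obtain p where p: "w = Z p" "p < r" by auto
    have "x * w = mpow r Z (t + Poly_Mapping.single p 1)"
      unfolding mpow_add mpow_single[OF p(2)] t p ..
    moreover have "t + Poly_Mapping.single p 1 \<in> mons r (Suc L)"
      using t(2) p(2) Poly_Mapping.keys_add[of t "Poly_Mapping.single p 1"]
      by (auto simp: mons_def)
    ultimately have "x * w \<in> mp.span (mpow r Z ` mons r (Suc L))"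
      by (simp add: mp.span_base)
    then show ?case using step(2)
      by (simp add: distrib_left mp.span_add mp.span_scale)
  qed
  then show ?case using step(2)
    by (simp add: distrib_right mp.span_add mp.span_scale)
qed

text \<open>The monomials in a basis of the linear forms span all polynomials of degree at
  most \<open>L\<close>, and there are no more of them than there are monomials in the variables.\<close>

lemma basis_mons_independent:
  fixes Z :: "nat \<Rightarrow> 'k::field mpoly"
  assumes Z: "homog n 1 \<subseteq> mp.span (Z ` {..<Suc n})"
  shows "mp.dim (mpow (Suc n) Z ` mons (Suc n) L) = card (mons (Suc n) L)"
proof (rule antisym)
  have X: "Poly_Mapping.single t 1 \<in> mp.span (mpow (Suc n) Z ` mons (Suc n) L)"
    if "t \<in> mons (Suc n) L" for t L
    using that
  proof (induction L arbitrary: t)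
    case 0
    then have "mon_degree t = 0" by (simp add: mons_def)
    then have "t = 0"
      using lookup_le_mon_degree[of t] by (intro poly_mapping_eqI) simp
    then have "Poly_Mapping.single t 1 = mpow (Suc n) Z t" by simp
    then show ?case using 0 by (simp add: mp.span_base)
  next
    case (Suc L)
    then have t: "Poly_Mapping.keys t \<subseteq> {..<Suc n}" "mon_degree t \<le> Suc L"
      by (simp_all add: mons_def)
    from t(1) show ?case
    proof (cases rule: exponent_cases)
      case 1
      then have "Poly_Mapping.single t 1 = mpow (Suc n) Z t" by simp
      then show ?thesis using Suc.prems by (simp add: mp.span_base)
    next
      case (2 i s)
      then have "s \<in> mons (Suc n) L" using t(2) by (simp add: mons_def)
      from Suc.IH[OF this] have s: "Poly_Mapping.single s 1 \<in> mp.span (mpow (Suc n) Z ` mons (Suc n) L)" .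
      have "Poly_Mapping.single (Poly_Mapping.single i 1) (1::'k) \<in> homog n 1"
        using 2(1) by (auto simp: mem_homog)
      from span_mons_mult[OF s subsetD[OF Z this]] show ?thesis
        unfolding 2(3) by (simp add: mult_single)
    qed
  qed
  have "card (mons (Suc n) L) = mp.dim ((\<lambda>t. Poly_Mapping.single t (1 :: 'k)) ` mons (Suc n) L)"
    by (rule dim_single_image[symmetric]) simp
  also have "\<dots> \<le> mp.dim (mpow (Suc n) Z ` mons (Suc n) L)"
    by (rule mp.dim_mono_finite) (use X in auto)
  finally show "card (mons (Suc n) L) \<le> mp.dim (mpow (Suc n) Z ` mons (Suc n) L)" .
qed (rule mp.dim_image_le_card[OF finite_mons])

lemma mpow_extend:
  assumes "Poly_Mapping.keys t \<subseteq> {..<r}" "r \<le> r'"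
  shows "mpow r' Z t = mpow r Z t"
  unfolding mpow_def
proof (rule prod.mono_neutral_right)
  show "\<forall>i\<in>{..<r'} - {..<r}. Z i ^ Poly_Mapping.lookup t i = 1"
  proof
    fix i assume "i \<in> {..<r'} - {..<r}"
    then have "i \<notin> Poly_Mapping.keys t" using assms(1) by auto
    then show "Z i ^ Poly_Mapping.lookup t i = 1" by (simp add: in_keys_iff)
  qed
qed (use assms(2) in auto)

text \<open>A basis of the span of \<open>Y\<close> extends to a basis of all linear forms, whose
  monomials are independent by counting; those in the smaller basis are a subfamily. Algebraic
  independence is thus reduced to linear independence.\<close>

lemma ex_independent_forms:
  fixes Y :: "'k::field mpoly set"
  assumes "Y \<subseteq> homog n 1"
  shows "\<exists>r Z. (\<forall>p<r. Z p \<in> Y) \<and> Y \<subseteq> mp.span (Z ` {..<r}) \<and>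
    (\<forall>L. mp.dim (mpow r Z ` mons r L) = card (mons r L))"
proof -
  obtain B where B: "B \<subseteq> Y" "mp.independent B" "Y \<subseteq> mp.span B" "card B = mp.dim Y"
    by (rule mp.basis_exists)
  obtain C where C: "B \<subseteq> C" "C \<subseteq> homog n 1" "mp.independent C" "homog n 1 \<subseteq> mp.span C"
    by (rule mp.maximal_independent_subset_extend[OF order_trans[OF B(1) assms] B(2)])
  have card: "card C = Suc n"
    using mp.basis_card_eq_dim[OF C(2,4,3)] by (simp add: dim_linear_forms)
  then have "finite C" by (metis card.infinite nat.distinct(1))
  then have "finite B" "finite (C - B)" using C(1) by (auto intro: finite_subset)
  then obtain xs ys where xs: "set xs = B" "distinct xs" and ys: "set ys = C - B" "distinct ys"
    using finite_distinct_list by metis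
  \<comment> \<open>The elements of \<open>B\<close> come first, so that monomials in the first
    \<open>length xs\<close> positions are exactly those in \<open>B\<close>.\<close>
  define Z where "Z p = (xs @ ys) ! p" for p
  have "distinct (xs @ ys)" using xs ys by auto
  moreover have "set (xs @ ys) = C" using xs ys C(1) by auto
  ultimately have len: "length (xs @ ys) = Suc n" using card distinct_card[of "xs @ ys"] by simp
  have ZC: "Z ` {..<Suc n} = C"
    using \<open>set (xs @ ys) = C\<close> unfolding Z_def set_conv_nth len by auto
  have ZB: "Z ` {..<length xs} = B"
    using xs(1) unfolding Z_def set_conv_nth by (auto simp: nth_append)
  have le: "length xs \<le> Suc n" using len by simp
  show ?thesis
  proof (intro exI conjI allI impI)
    show "Z p \<in> Y" if "p < length xs" for p
      using ZB B(1) that by auto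
    show "Y \<subseteq> mp.span (Z ` {..<length xs})" unfolding ZB by (rule B(3))
    fix L
    have "mp.dim (mpow (Suc n) Z ` mons (length xs) L) = card (mons (length xs) L)"
      by (rule mp.dim_image_eq_card_subset[OF finite_mons basis_mons_independent mons_mono[OF le order_refl]])
        (use C(4) in \<open>simp add: ZC\<close>)
    moreover have "mpow (Suc n) Z ` mons (length xs) L = mpow (length xs) Z ` mons (length xs) L"
      by (rule image_cong[OF refl], rule mpow_extend) (use le in \<open>simp_all add: mons_def\<close>)
    ultimately show "mp.dim (mpow (length xs) Z ` mons (length xs) L) = card (mons (length xs) L)"
      by simp
  qed
qed

lemma a_inv_mpoly_ring:
  fixes x :: "'k::field mpoly"
  assumes "ring (mpoly_ring n :: 'k mpoly ring)" "x \<in> carrier (mpoly_ring n)"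
  shows "\<ominus>\<^bsub>mpoly_ring n\<^esub> x = - x"
proof -
  interpret ring "mpoly_ring n :: 'k mpoly ring" by fact
  show ?thesis
    using assms(2) mp.subspace_neg[OF subspace_carrier assms(2)]
    by (intro minus_equality) (simp_all add: mpoly_ring_def)
qed

text \<open>Forms of \<open>Y\<close> outside the chosen family are combinations of it and enlarge
  nothing. This turns the inductively generated ring of scalars into a span of monomials.\<close>

lemma generate_ring_eq_mono_span:
  fixes Z :: "nat \<Rightarrow> 'k::field mpoly"
  assumes R: "ring (mpoly_ring n :: 'k mpoly ring)" and Y: "Y \<subseteq> homog n 1"
    and Z: "\<And>p. p < r \<Longrightarrow> Z p \<in> Y" "Y \<subseteq> mp.span (Z ` {..<r})"
  shows "generate_ring (mpoly_ring n) (scalars \<union> Y) = mono_span r Z" (is "?G = _")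
proof
  have carr: "mono_span r Z \<subseteq> carrier (mpoly_ring n)"
    by (rule mono_span_carrier) (use Y Z(1) in auto)
  have var: "Z p \<in> mono_span r Z" if "p < r" for p
    using mpow_in_mono_span[of "Poly_Mapping.single p 1" r Z] that
    by (simp only: mpow_single) simp
  have "mp.span (Z ` {..<r}) \<subseteq> mono_span r Z"
    by (rule mp.span_minimal[OF _ subspace_mono_span]) (use var in auto)
  then have Y': "Y \<subseteq> mono_span r Z" using Z(2) by simp
  show "?G \<subseteq> mono_span r Z"
  proof
    fix x assume "x \<in> ?G"
    then show "x \<in> mono_span r Z"
    proof induction
      case one
      show ?case by (simp add: mpoly_ring_def one_in_mono_span)
    next
      case (incl h)
      then show ?case
      proof
        assume "h \<in> scalars"
        then obtain c where "h = cscale c 1" by (auto simp: scalars_def cscale_def)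
        then show ?thesis
          using mp.subspace_scale[OF subspace_mono_span one_in_mono_span] by simp
      next
        assume "h \<in> Y"
        then show ?thesis using Y' by (rule rev_subsetD)
      qed
    next
      case (a_inv h)
      have "h \<in> carrier (mpoly_ring n)" using carr a_inv.IH by (rule subsetD)
      from a_inv_mpoly_ring[OF R this] show ?case
        using mp.subspace_neg[OF subspace_mono_span a_inv.IH] by simp
    next
      case (eng_add h1 h2)
      then show ?case
        using mp.subspace_add[OF subspace_mono_span] by (simp add: mpoly_ring_def)
    next
      case (eng_mult h1 h2)
      then show ?case
        using mono_span_mult by (simp add: mpoly_ring_def)
    qed
  qed
  have mult: "x * y \<in> ?G" if "x \<in> ?G" "y \<in> ?G" for x y
    using generate_ring.eng_mult[OF that] by (simp add: mpoly_ring_def)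
  have add: "x + y \<in> ?G" if "x \<in> ?G" "y \<in> ?G" for x y
    using generate_ring.eng_add[OF that] by (simp add: mpoly_ring_def)
  have scalar: "Poly_Mapping.single 0 c \<in> ?G" for c
    by (rule generate_ring.incl) (simp add: scalars_def)
  have "mp.subspace ?G"
  proof (rule mp.subspaceI)
    show "0 \<in> ?G" using scalar[of 0] by simp
    show "cscale c x \<in> ?G" if "x \<in> ?G" for c x
      unfolding cscale_def by (rule mult[OF scalar that])
  qed (rule add)
  moreover have "mpow r Z t \<in> ?G" if t: "Poly_Mapping.keys t \<subseteq> {..<r}" for t
  proof (rule mpow_graded[where H = "\<lambda>_. ?G"])
    show "1 \<in> ?G" using scalar[of 1] by simp
    show "Z p \<in> ?G" if "p < r" for p
      by (rule generate_ring.incl) (use Z(1)[OF that] in simp)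
  qed (rule mult, assumption, assumption, rule t)
  ultimately show "mono_span r Z \<subseteq> ?G" by (rule mono_span_subset)
qed

section \<open>Homogeneous components\<close>

definition homog_part :: "int \<Rightarrow> 'k::field mpoly \<Rightarrow> 'k mpoly" where
  "homog_part e = Poly_Mapping.mapp (\<lambda>t c. c when int (mon_degree t) = e)"

lemma lookup_homog_part:
  "Poly_Mapping.lookup (homog_part e p) t = (Poly_Mapping.lookup p t when int (mon_degree t) = e)"
  by (auto simp: homog_part_def lookup_mapp in_keys_iff when_def)

lemma homog_part_homog:
  assumes "p \<in> homog n l"
  shows "homog_part e p = (if l = e then p else 0)"
proof (rule poly_mapping_eqI)
  fix t
  show "Poly_Mapping.lookup (homog_part e p) t = Poly_Mapping.lookup (if l = e then p else 0) t"
    using assms by (cases "t \<in> Poly_Mapping.keys p")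
      (auto simp: lookup_homog_part mem_homog when_def in_keys_iff)
qed

text \<open>Projection to degree \<open>e\<close> fixes \<open>x\<close> and deletes the monomials
  of other degrees from any expression of \<open>x\<close>.\<close>

lemma mono_span_homog:
  assumes Z: "\<And>p. p < r \<Longrightarrow> Z p \<in> homog n 1"
    and x: "x \<in> mono_span r Z" "x \<in> homog n e"
  shows "x \<in> mp.span (mpow r Z ` {t. Poly_Mapping.keys t \<subseteq> {..<r} \<and> int (mon_degree t) = e})"
    (is "_ \<in> ?S")
proof -
  have "homog_part e x \<in> ?S"
    using x(1) unfolding mono_span_def
  proof (induction rule: mp.span_induct_alt)
    case base
    have "homog_part e (0 :: 'a mpoly) = 0"
      by (rule poly_mapping_eqI) (simp add: lookup_homog_part)
    then show ?case by (simp add: mp.span_zero)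
  next
    case (step c p q)
    from step(1) obtain t where t: "p = mpow r Z t" "Poly_Mapping.keys t \<subseteq> {..<r}" by auto
    have "homog_part e p = (if int (mon_degree t) = e then p else 0)"
      unfolding t(1) by (rule homog_part_homog[OF mpow_homog[OF Z t(2)]])
    then have "homog_part e p \<in> ?S"
      using t by (auto simp: mp.span_zero intro!: mp.span_base)
    moreover have "homog_part e (cscale c p + q) = cscale c (homog_part e p) + homog_part e q"
      by (rule poly_mapping_eqI) (simp add: lookup_homog_part lookup_add when_def)
    ultimately show ?case using step(2) by (simp add: mp.span_add mp.span_scale)
  qed
  then show ?thesis by (simp add: homog_part_homog[OF x(2)])
qed

subsection \<open>Extracting a basis from a graded isomorphism\<close>

context graded_quotient
begin

abbreviation coset :: "'k mpoly \<Rightarrow> 'k mpoly set" where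
  "coset f \<equiv> I +>\<^bsub>mpoly_ring n\<^esub> f"

lemma coset_eq: "coset f = (\<lambda>i. i + f) ` I"
  by (auto simp: a_r_coset_def' mpoly_ring_def)

lemma mem_coset: "g \<in> coset f \<longleftrightarrow> g - f \<in> I"
proof
  assume "g - f \<in> I"
  then have "(g - f) + f \<in> coset f" unfolding coset_eq by (rule imageI)
  then show "g \<in> coset f" by simp
qed (auto simp: coset_eq)

lemma coset_eq_iff: "coset f = coset g \<longleftrightarrow> f - g \<in> I"
proof
  assume "coset f = coset g"
  moreover have "f \<in> coset f" unfolding mem_coset using mp.subspace_0[OF subspace_I] by simp
  ultimately show "f - g \<in> I" by (simp add: mem_coset)
next
  assume fg: "f - g \<in> I"
  have "x - f \<in> I \<longleftrightarrow> x - g \<in> I" for x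
    using mp.subspace_add[OF subspace_I _ fg, of "x - f"] mp.subspace_diff[OF subspace_I _ fg, of "x - g"]
    by auto
  then show "coset f = coset g" by (simp add: set_eq_iff mem_coset)
qed

lemma coset_add: "coset f \<oplus>\<^bsub>coord_ring n I\<^esub> coset g = coset (f + g)"
proof -
  have "coset f \<oplus>\<^bsub>coord_ring n I\<^esub> coset g = (\<Union>h\<in>coset f. \<Union>k\<in>coset g. {h + k})"
    by (simp add: coord_ring_def FactRing_def set_add_def' mpoly_ring_def)
  also have "\<dots> = coset (f + g)"
  proof (intro equalityI subsetI)
    fix x assume "x \<in> (\<Union>h\<in>coset f. \<Union>k\<in>coset g. {h + k})"
    then obtain h k where x: "x = h + k" "h - f \<in> I" "k - g \<in> I"
      by (auto simp: mem_coset)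
    from mp.subspace_add[OF subspace_I x(2,3)] show "x \<in> coset (f + g)"
      by (simp add: mem_coset x(1) algebra_simps)
  next
    fix x assume "x \<in> coset (f + g)"
    then have "x - g \<in> coset f" by (simp add: mem_coset algebra_simps)
    moreover have "g \<in> coset g" using mp.subspace_0[OF subspace_I] by (simp add: mem_coset)
    ultimately show "x \<in> (\<Union>h\<in>coset f. \<Union>k\<in>coset g. {h + k})"
      by (intro UN_I[of "x - g"] UN_I[of g]) simp_all
  qed
  finally show ?thesis .
qed

lemma coset_mult:
  assumes I: "I \<subseteq> carrier (mpoly_ring n)"
    and f: "f \<in> carrier (mpoly_ring n)" and g: "g \<in> carrier (mpoly_ring n)"
  shows "coset f \<otimes>\<^bsub>coord_ring n I\<^esub> coset g = coset (f * g)"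
proof -
  have "coset f \<otimes>\<^bsub>coord_ring n I\<^esub> coset g = (\<Union>h\<in>coset f. \<Union>k\<in>coset g. coset (h * k))"
    by (simp add: coord_ring_def FactRing_def rcoset_mult_def mpoly_ring_def)
  also have "coset (h * k) = coset (f * g)" if h: "h \<in> coset f" and k: "k \<in> coset g" for h k
  proof -
    have hk: "h - f \<in> I" "k - g \<in> I" using h k by (simp_all add: mem_coset)
    have "(k - g) + g \<in> carrier (mpoly_ring n)"
      using hk(2) I g by (intro mp.subspace_add[OF subspace_carrier]) auto
    then have "k * (h - f) \<in> I" using hk(1) by (intro absorbingD[OF absorb]) simp_all
    moreover have "f * (k - g) \<in> I" using hk(2) f by (intro absorbingD[OF absorb])
    ultimately have "k * (h - f) + f * (k - g) \<in> I" by (rule mp.subspace_add[OF subspace_I])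
    then show ?thesis unfolding coset_eq_iff by (simp add: algebra_simps)
  qed
  then have "(\<Union>h\<in>coset f. \<Union>k\<in>coset g. coset (h * k)) = (\<Union>h\<in>coset f. \<Union>k\<in>coset g. coset (f * g))"
    by simp
  also have "f \<in> coset f" "g \<in> coset g"
    using mp.subspace_0[OF subspace_I] by (simp_all add: mem_coset)
  then have "(\<Union>h\<in>coset f. \<Union>k\<in>coset g. coset (f * g)) = coset (f * g)" by auto
  finally show ?thesis .
qed

text \<open>The basis consists of representatives of the images of the unit vectors. Surjectivity of
  \<open>h\<close> on each component gives spanning with degree control; injectivity gives
  freeness.\<close>

lemma free_on_of_free_with_shifts:
  assumes R: "ring (mpoly_ring n :: 'k mpoly ring)"
    and I: "I \<subseteq> carrier (mpoly_ring n)" and J: "J \<subseteq> carrier (mpoly_ring n)"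
    and Ys: "set Ys \<subseteq> homog n 1"
    and free: "free_with_shifts n Ys (quot_module n J I) d s"
  shows "\<exists>r Z b. free_on J r Z d (\<lambda>i. s ! i) b"
proof -
  from ex_independent_forms[OF Ys] obtain r Z where Zin': "\<forall>p<r. Z p \<in> set Ys"
    and Zspan: "set Ys \<subseteq> mp.span (Z ` {..<r})"
    and ind: "\<forall>L. mp.dim (mpow r Z ` mons r L) = card (mons r L)"
    by (elim exE conjE) (rule that)
  from Zin' have Zin: "\<And>p. p < r \<Longrightarrow> Z p \<in> set Ys" by simp
  define A where "A = mono_span r Z"
  have Z: "Z p \<in> homog n 1" if "p < r" for p using Zin[OF that] Ys by (rule rev_subsetD)
  have AC: "A \<subseteq> carrier (mpoly_ring n)" 
    unfolding A_def
  proof (rule mono_span_carrier)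
    fix p assume "p < r"
    then show "Z p \<in> homog n 1" by (rule Z)
  qed
  have A: "mp.subspace A" unfolding A_def by (rule subspace_mono_span)
  have A1: "1 \<in> A" unfolding A_def by (rule one_in_mono_span)
  have lin: "carrier (lin_ring n Ys) = A"
    using generate_ring_eq_mono_span[OF R Ys Zin Zspan] by (simp add: lin_ring_def A_def)
  let ?P = "\<Pi>\<^sub>E i\<in>{..<d}. A"
  obtain h where bij: "bij_betw h ?P (coset ` J)"
    and add: "\<And>x y. x \<in> ?P \<Longrightarrow> y \<in> ?P \<Longrightarrow>
      h (\<lambda>i\<in>{..<d}. x i + y i) = h x \<oplus>\<^bsub>coord_ring n I\<^esub> h y"
    and smult: "\<And>a x. a \<in> A \<Longrightarrow> x \<in> ?P \<Longrightarrow>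
      h (\<lambda>i\<in>{..<d}. a * x i) = coset a \<otimes>\<^bsub>coord_ring n I\<^esub> h x"
    and comp: "\<And>l. h ` (\<Pi>\<^sub>E i\<in>{..<d}. A \<inter> homog n (- int (s ! i) + l))
      = coset ` (J \<inter> homog n l)"
    using free unfolding free_with_shifts_def graded_iso_def
    by (auto simp: direct_sum_def shift_def lin_module_def quot_module_def lin)
  define e where "e i = (\<lambda>j\<in>{..<d}. if j = i then 1 else 0 :: 'k mpoly)" for i
  have eP: "e i \<in> ?P" for i
    using A1 mp.subspace_0[OF A] by (auto simp: e_def)
  have "\<exists>f. f \<in> J \<inter> homog n (int (s ! i)) \<and> h (e i) = coset f" if "i < d" for i
  proof -
    \<comment> \<open>In degree \<open>s ! i\<close> the \<open>i\<close>-th summand contributes its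
      elements of degree \<open>0\<close>, among them \<open>1\<close>; the other coordinates are
      \<open>0\<close>, which is homogeneous of every degree.\<close>
    have "e i \<in> (\<Pi>\<^sub>E j\<in>{..<d}. A \<inter> homog n (- int (s ! j) + int (s ! i)))"
      using A1 mp.subspace_0[OF A] mp.subspace_0[OF subspace_homog] one_in_homog
      by (auto simp: e_def)
    then have "h (e i) \<in> coset ` (J \<inter> homog n (int (s ! i)))"
      unfolding comp[symmetric] by (rule imageI)
    then show ?thesis by auto
  qed
  then have "\<forall>i. \<exists>f. i < d \<longrightarrow> f \<in> J \<inter> homog n (int (s ! i)) \<and> h (e i) = coset f" by auto
  from choice[OF this] obtain b
    where b: "\<And>i. i < d \<Longrightarrow> b i \<in> J \<inter> homog n (int (s ! i))"
      and hb: "\<And>i. i < d \<Longrightarrow> h (e i) = coset (b i)"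
    by auto
  \<comment> \<open>The isomorphism is given by its values on sums and multiples; that it sends zero
    to zero follows from multiplying by the scalar \<open>0\<close>.\<close>
  have h0: "h (\<lambda>i\<in>{..<d}. 0) = coset 0"
  proof -
    have P0: "(\<lambda>i\<in>{..<d}. 0) \<in> ?P" using mp.subspace_0[OF A] by auto
    then have "h (\<lambda>i\<in>{..<d}. 0) \<in> coset ` J" using bij by (rule bij_betwE[THEN bspec, rotated])
    then obtain f where f: "f \<in> J" "h (\<lambda>i\<in>{..<d}. 0) = coset f" by auto
    have "h (\<lambda>i\<in>{..<d}. 0) = coset 0 \<otimes>\<^bsub>coord_ring n I\<^esub> coset f"
      using smult[OF mp.subspace_0[OF A] P0] f(2) by (simp cong: restrict_cong)
    also have "\<dots> = coset (0 * f)"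
      using f(1) J by (intro coset_mult[OF I] mp.subspace_0[OF subspace_carrier]) auto
    finally show ?thesis by simp
  qed
  have hx: "h x = coset (\<Sum>i<d. x i * b i)" if x: "x \<in> ?P" for x
  proof -
    have xA: "x i \<in> A" if "i < d" for i using x that by auto
    \<comment> \<open>\<open>x\<close> cut off after its first \<open>k\<close> coordinates:
      additivity for two summands is applied one coordinate at a time.\<close>
    define y where "y k = (\<lambda>i\<in>{..<d}. if i < k then x i else 0)" for k
    have "h (y k) = coset (\<Sum>i<k. x i * b i)" if "k \<le> d" for k
      using that
    proof (induction k)
      case 0
      have y0: "y 0 = (\<lambda>i\<in>{..<d}. 0)" by (rule ext) (simp add: y_def)
      show ?case unfolding y0 lessThan_0 sum.empty by (rule h0)
    next
      case (Suc k)
      then have k: "k < d" by simp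
      have yP: "y k \<in> ?P" using xA mp.subspace_0[OF A] by (auto simp: y_def)
      define z where "z = (\<lambda>i\<in>{..<d}. x k * e k i)"
      have zP: "z \<in> ?P"
        using xA[OF k] mp.subspace_0[OF A] by (auto simp: z_def e_def)
      have "y (Suc k) = (\<lambda>i\<in>{..<d}. y k i + z i)"
        by (rule ext) (auto simp: y_def z_def e_def less_Suc_eq)
      then have "h (y (Suc k)) = h (y k) \<oplus>\<^bsub>coord_ring n I\<^esub> h z"
        using add[OF yP zP] by simp
      also have "h z = coset (x k) \<otimes>\<^bsub>coord_ring n I\<^esub> coset (b k)"
        unfolding z_def hb[OF k, symmetric] by (rule smult[OF xA[OF k] eP])
      also have "\<dots> = coset (x k * b k)"
        using xA[OF k] AC b[OF k] J by (intro coset_mult[OF I]) auto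
      finally show ?case using Suc.IH k by (simp add: coset_add)
    qed
    moreover have "y d = x"
    proof
      fix i show "y d i = x i"
        using PiE_arb[OF x, of i] by (simp add: y_def)
    qed
    ultimately show ?thesis by (metis order_refl)
  qed
  have "free_on J r Z d (\<lambda>i. s ! i) b"
    unfolding free_on_def
  proof (intro conjI allI impI)
    fix L
    show "\<pi> ` filt n J L \<subseteq> mp.span (\<pi> ` gen r Z b ` idx r d (\<lambda>i. s ! i) L)" (is "_ \<subseteq> ?S")
    proof (rule image_subsetI)
      fix f assume "f \<in> filt n J L"
      then obtain l where l: "l \<le> L" "f \<in> J \<inter> homog n (int l)" by (auto simp: filt_def)
      have "coset f \<in> h ` (\<Pi>\<^sub>E i\<in>{..<d}. A \<inter> homog n (- int (s ! i) + int l))"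
        unfolding comp using l(2) by (rule imageI)
      then obtain x where xf: "coset f = h x"
        and x: "x \<in> (\<Pi>\<^sub>E i\<in>{..<d}. A \<inter> homog n (- int (s ! i) + int l))" by (rule imageE)
      have xi: "x i \<in> A" "x i \<in> homog n (- int (s ! i) + int l)" if "i < d" for i
        using x that by auto
      have "x \<in> ?P" using x by (auto simp: PiE_iff)
      from hx[OF this] xf have "f - (\<Sum>i<d. x i * b i) \<in> I" by (simp add: coset_eq_iff)
      then have "\<pi> f = (\<Sum>i<d. \<pi> (x i * b i))"
        by (simp add: kernel[symmetric] l.diff l.sum)
      also have "\<dots> \<in> ?S"
      proof (rule mp.span_sum)
        fix i assume "i \<in> {..<d}"
        then have i: "i < d" by simp
        have "x i \<in> mp.span (mpow r Z ` {t. Poly_Mapping.keys t \<subseteq> {..<r}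
            \<and> int (mon_degree t) = - int (s ! i) + int l})"
          by (rule mono_span_homog[OF Z]) (use xi[OF i] in \<open>simp_all add: A_def\<close>)
        then show "\<pi> (x i * b i) \<in> ?S"
        proof (induction rule: mp.span_induct_alt)
          case base
          show ?case by (simp add: mp.span_zero l.zero)
        next
          case (step c p q)
          from step(1) obtain t where t: "p = mpow r Z t" "Poly_Mapping.keys t \<subseteq> {..<r}"
            "int (mon_degree t) = - int (s ! i) + int l" by auto
          then have "(i, t) \<in> idx r d (\<lambda>i. s ! i) L" using i l(1) by (simp add: mem_idx)
          then have "\<pi> (gen r Z b (i, t)) \<in> ?S" by (intro mp.span_base imageI)
          then show ?case using step(2)
            by (simp add: t(1) gen_eq distrib_right l.add l.scale mp.span_add mp.span_scale)
        qed
      qed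
      finally show "\<pi> f \<in> ?S" .
    qed
  next
    fix \<rho> i
    assume \<rho>: "\<forall>i<d. \<rho> i \<in> mp.span (mpow r Z ` {t. Poly_Mapping.keys t \<subseteq> {..<r}})"
      and sum: "(\<Sum>i<d. \<rho> i * b i) \<in> I" and i: "i < d"
    define x where "x = (\<lambda>i\<in>{..<d}. \<rho> i)"
    have x: "x \<in> ?P" using \<rho> by (auto simp: x_def A_def mono_span_def)
    have "(\<Sum>i<d. x i * b i) = (\<Sum>i<d. \<rho> i * b i)"
      by (rule sum.cong) (simp_all add: x_def)
    then have "h x = h (\<lambda>i\<in>{..<d}. 0)"
      using sum unfolding hx[OF x] h0 coset_eq_iff by simp
    moreover have "(\<lambda>i\<in>{..<d}. 0) \<in> ?P" using mp.subspace_0[OF A] by auto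
    ultimately have "x = (\<lambda>i\<in>{..<d}. 0)"
      using x bij_betw_imp_inj_on[OF bij] by (intro inj_onD[of h])
    from fun_cong[OF this, of i] show "\<rho> i = 0" using i by (simp add: x_def)
  qed (use Z b ind in auto)
  then show ?thesis by blast
qed

end

section \<open>Comparison of shifts for ideals of \<open>A_n\<close>\<close>

lemma free_shifts_le:
  fixes I J1 J2 :: "'k::field mpoly set"
  assumes inf: "infinite (UNIV :: 'k set)"
    and I: "ideal I (mpoly_ring n)" and J1: "ideal J1 (mpoly_ring n)" and J2: "ideal J2 (mpoly_ring n)"
    and sub: "J1 \<subseteq> J2" and Y: "set Y1 \<subseteq> homog n 1" "set Y2 \<subseteq> homog n 1"
    and free1: "free_with_shifts n Y1 (quot_module n J1 I) d1 s1"
    and free2: "free_with_shifts n Y2 (quot_module n J2 I) d2 s2"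
    and i: "i < d1" "i < d2"
  shows "s2 ! i \<le> s1 ! i"
proof -
  have abs: "absorbing n J" if "ideal J (mpoly_ring n)" for J :: "'k mpoly set"
    using ideal.I_l_closed[OF that] by (auto simp: absorbing_def mpoly_ring_def)
  have carr: "J \<subseteq> carrier (mpoly_ring n)" if "ideal J (mpoly_ring n)" for J :: "'k mpoly set"
    using additive_subgroup.a_subset[OF ideal.axioms(1)[OF that]] .
  have R: "ring (mpoly_ring n :: 'k mpoly ring)" using I by (rule ideal.axioms(2))
  have "mp.subspace I"
  proof (rule mp.subspaceI)
    show "0 \<in> I"
      using additive_subgroup.zero_closed[OF ideal.axioms(1)[OF I]] by (simp add: mpoly_ring_def)
    show "x + y \<in> I" if "x \<in> I" "y \<in> I" for x y
      using additive_subgroup.a_closed[OF ideal.axioms(1)[OF I] that] by (simp add: mpoly_ring_def)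
    show "cscale c x \<in> I" if "x \<in> I" for c x
      unfolding cscale_def using that
      by (intro absorbingD[OF abs[OF I]]) (auto simp: mem_mpoly_ring)
  qed
  then obtain \<pi> where \<pi>: "Vector_Spaces.linear cscale cscale \<pi>" "\<And>x. \<pi> x = 0 \<longleftrightarrow> x \<in> I"
    using mp.ex_linear_kernel by auto
  interpret graded_quotient n I \<pi>
    by (rule graded_quotient.intro[OF \<pi> abs[OF I]])
  obtain r1 Z1 b1 where 1: "free_on J1 r1 Z1 d1 (\<lambda>i. s1 ! i) b1"
    using free_on_of_free_with_shifts[OF R carr[OF I] carr[OF J1] Y(1) free1] by auto
  obtain r2 Z2 b2 where 2: "free_on J2 r2 Z2 d2 (\<lambda>i. s2 ! i) b2"
    using free_on_of_free_with_shifts[OF R carr[OF I] carr[OF J2] Y(2) free2] by auto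
  have s: "length s1 = d1" "sorted s1" "length s2 = d2" "sorted s2"
    using free1 free2 by (auto simp: free_with_shifts_def)
  show ?thesis
    by (rule shifts_le[OF 1 2 abs[OF J1] abs[OF J2] sub inf _ _ i(1)])
      (use s i in \<open>auto intro: sorted_nth_mono\<close>)
qed

theorem mainTheorem4:
  fixes n m d :: nat
    and I\<^sub>X I\<^sub>Y :: "'k :: {alg_closed_field, field_char_0} mpoly set"
    and ms ns :: "nat list"
  assumes "m \<ge> 1"
    and "acm_pure n m I\<^sub>X"
    and "has_degree n m I\<^sub>X d"
    and "characteristic_sequence n m I\<^sub>X d ms"
    and "acm_hypersurface n m I\<^sub>X I\<^sub>Y"
    and "relative_characteristic_sequence n m I\<^sub>X I\<^sub>Y d ns"
  shows "(\<forall>i<d. ns ! i \<ge> ms ! i) \<and>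
    (\<forall>I\<^sub>Y' ns'. acm_hypersurface n m I\<^sub>X I\<^sub>Y' \<longrightarrow>
        relative_characteristic_sequence n m I\<^sub>X I\<^sub>Y' d ns' \<longrightarrow>
        I\<^sub>Y' \<subseteq> I\<^sub>Y \<longrightarrow>
        (\<forall>i<d. ns' ! i \<ge> ns ! i))"
proof -
  have ideal: "ideal J (mpoly_ring n)" if "acm_pure n k J" for J :: "'k mpoly set" and k
    using that by (simp add: acm_pure_def proj_subscheme_def homogeneous_ideal_def)
  have forms: "set Ys \<subseteq> homog n 1" if "linear_forms_avoiding n m I\<^sub>X Ys" for Ys
    using that by (simp add: linear_forms_avoiding_def)
  have IX: "ideal I\<^sub>X (mpoly_ring n)" using assms(2) by (rule ideal)
  have IY: "ideal I\<^sub>Y (mpoly_ring n)" using assms(5) ideal by (auto simp: acm_hypersurface_def)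
  \<comment> \<open>The whole ring counts as an ideal so that the coordinate ring of
    \<open>X\<close>, with shifts \<open>ms\<close>, becomes the larger module in the first
    comparison.\<close>
  have A: "ideal (carrier (mpoly_ring n)) (mpoly_ring n :: 'k mpoly ring)"
    by (rule ring.oneideal[OF ideal.axioms(2)[OF IX]])
  have sub: "I\<^sub>Y \<subseteq> carrier (mpoly_ring n)"
    by (rule additive_subgroup.a_subset[OF ideal.axioms(1)[OF IY]])
  obtain Y1 where Y1: "linear_forms_avoiding n m I\<^sub>X Y1"
    "free_with_shifts n Y1 (quot_module n (carrier (mpoly_ring n)) I\<^sub>X) d ms"
    using assms(4) by (auto simp: characteristic_sequence_def)
  obtain Y2 where Y2: "linear_forms_avoiding n m I\<^sub>X Y2"
    "free_with_shifts n Y2 (quot_module n I\<^sub>Y I\<^sub>X) d ns"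
    using assms(6) by (auto simp: relative_characteristic_sequence_def)
  note le = free_shifts_le[OF infinite_UNIV_char_0 IX]
  show ?thesis
  proof (intro conjI allI impI)
    fix i assume i: "i < d"
    show "ms ! i \<le> ns ! i"
      by (rule le[OF IY A sub forms[OF Y2(1)] forms[OF Y1(1)] Y2(2) Y1(2) i i])
  next
    fix I\<^sub>Y' ns' i
    assume Y': "acm_hypersurface n m I\<^sub>X I\<^sub>Y'" "relative_characteristic_sequence n m I\<^sub>X I\<^sub>Y' d ns'"
      "I\<^sub>Y' \<subseteq> I\<^sub>Y" and i: "i < d"
    have IY': "ideal I\<^sub>Y' (mpoly_ring n)" using Y'(1) ideal by (auto simp: acm_hypersurface_def)
    obtain Y3 where Y3: "linear_forms_avoiding n m I\<^sub>X Y3"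
      "free_with_shifts n Y3 (quot_module n I\<^sub>Y' I\<^sub>X) d ns'"
      using Y'(2) by (auto simp: relative_characteristic_sequence_def)
    \<comment> \<open>The inclusion of \<open>Y\<close> in \<open>Y'\<close> reverses for ideals, so
      \<open>Y'\<close> gives the smaller module and hence the larger shifts.\<close>
    show "ns ! i \<le> ns' ! i"
      by (rule le[OF IY' IY Y'(3) forms[OF Y3(1)] forms[OF Y2(1)] Y3(2) Y2(2) i i])
  qed
qed

end
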